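(* For $\#\in\{0,1\}$ let $\mathsf b_L^{(\#)}=V^{-(1+\#)/2}\,\mathbf 1_{I_L^d}$ and define the order parameters $$\mathsf o^{(\#)}=\lim_{L\to\infty} i\,\omega_L\big(R(1,\mathsf b_L^{(\#)})\big)\in[0,1],$$ where $\omega_L$ is the grand canonical state of the free Bose gas in the box $I_L^d$ at inverse temperature $\beta$ and fixed mean density $\bar\rho$. The following are equivalent: (1) Bose–Einstein condensation occurs (the zero mode is meaningful), i.e. $\rho_0(\beta)>0$; (2) $\mathsf o^{(0)}=0$; (3) $\mathsf o^{(1)}<1$.
   Context: $d=3$, $s\ge1$, $h(k)=|k|^s$, $\beta>0$, $\bar\rho>0$. For $L>0$: $I_L=[-L/2,L/2]$, $V=L^d$, momentum lattice $\Gamma_L^d=(\frac{2\pi}{L}\mathbb Z)^d$. For $f\in L^2(I_L^d)$ put $f_k=(2\pi)^{-d/2}\int_{I_L^d}e^{-ik\cdot x}f(x)dx$, $k\in\Gamma_L^d$. Fixed density: for $y>1$ (with $y=e^{-\beta\mu}$, chemical potential $\mu<0$) let $\rho_V(\beta,y)=\frac1V\sum_{k\in\Gamma_L^d}(ye^{\beta h(k)}-1)^{-1}$; $y_V>1$ is the unique solution of $\rho_V(\beta,y_V)=\bar\rho$. With $N_0(y)=\frac1{y-1}$, the condensate density is $\rho_0(\beta)=\lim_{V\to\infty}\frac1VN_0(y_V)$; with $\rho_c(\beta)=(2\pi)^{-d}\int(e^{\beta h(k)}-1)^{-1}dk$ one has $\rho_0(\beta)=\max(\bar\rho-\rho_c(\beta),0)$.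 State: with $\mu_V<0$ given by $y_V=e^{-\beta\mu_V}$, put $q_L(f)=\frac{(2\pi)^d}{V}\sum_{k\in\Gamma_L^d}\frac{1+e^{-\beta(h(k)-\mu_V)}}{1-e^{-\beta(h(k)-\mu_V)}}|f_k|^2$ (where finite). $\omega_L$ is the regular quasi-free state with $\omega_L(W(f))=e^{-\frac14q_L(f)}$, where $W(f)=e^{i\phi(f)}$ are the Weyl operators of the field $\phi$ and $R(\lambda,f)=(i\lambda-\phi(f))^{-1}$ is the resolvent; thus $i\,\omega_L(R(1,f))=\int_0^\infty e^{-t}\,\omega_L(W(-tf))\,dt$.
   Formalization: The implications from (2) to (1) and (3) are stated only for mean density different from ρ_c(β), because at ρ̄ = ρ_c(β) < ∞ one has o^(0) = 0 but ρ_0(β) = 0 and o^(1) = 1; (1)⇔(3) and (1)⇒(2) hold without restriction. *)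

theory Defs
  imports "HOL-Analysis.Analysis"
begin

section \<open>Finite volume thermodynamics of the free Bose gas in three dimensions\<close>

definition cube :: "real \<Rightarrow> (real ^ 3) set" where
  "cube L = cbox (\<chi> i. - L / 2) (\<chi> i. L / 2)"

definition vol :: "real \<Rightarrow> real" where
  "vol L = L ^ 3"

definition momentum_lattice :: "real \<Rightarrow> (real ^ 3) set" where
  "momentum_lattice L = {k. \<forall>i. \<exists>n::int. k $ i = 2 * pi / L * of_int n}"

text \<open>The exponent is an arbitrary real; \<open>0 powr s = 0\<close>, so the zero mode has energy \<open>0\<close>.\<close>

definition energy :: "real \<Rightarrow> real ^ 3 \<Rightarrow> real" where
  "energy s k = norm k powr s"

definition mean_density :: "real \<Rightarrow> real \<Rightarrow> real \<Rightarrow> real \<Rightarrow> real" where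
  "mean_density s \<beta> L y =
     1 / vol L * (\<Sum>\<^sub>\<infinity>k\<in>momentum_lattice L. 1 / (y * exp (\<beta> * energy s k) - 1))"

definition inv_fugacity :: "real \<Rightarrow> real \<Rightarrow> real \<Rightarrow> real \<Rightarrow> real" where
  "inv_fugacity s \<beta> \<rho> L = (THE y. y > 1 \<and> mean_density s \<beta> L y = \<rho>)"

definition chem_potential :: "real \<Rightarrow> real \<Rightarrow> real \<Rightarrow> real \<Rightarrow> real" where
  "chem_potential s \<beta> \<rho> L = - ln (inv_fugacity s \<beta> \<rho> L) / \<beta>"

definition zero_mode_number :: "real \<Rightarrow> real" where
  "zero_mode_number y = 1 / (y - 1)"

definition condensate_density :: "real \<Rightarrow> real \<Rightarrow> real \<Rightarrow> real" where
  "condensate_density s \<beta> \<rho> =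
     Lim at_top (\<lambda>L. zero_mode_number (inv_fugacity s \<beta> \<rho> L) / vol L)"

text \<open>The critical density takes values in \<open>[0, \<infinity>]\<close>; it is infinite precisely for \<open>s \<ge> 3\<close>,
  where the integrand is not integrable at the origin.  If it is finite and the mean density
  equals it exactly, then \<open>y\<^sub>V \<rightarrow> 1\<close>: the zero mode occupation diverges, but more slowly than the
  volume, so that the condensate density vanishes.\<close>

definition critical_density :: "real \<Rightarrow> real \<Rightarrow> ennreal" where
  "critical_density s \<beta> =
     ennreal (1 / (2 * pi) ^ 3) * (\<integral>\<^sup>+ k. ennreal (1 / (exp (\<beta> * energy s k) - 1)) \<partial>lborel)"

section \<open>One-particle space and covariance of the grand canonical state\<close>

text \<open>Elements of the one-particle space are represented by functions on the whole of
  \<open>\<real>\<^sup>3\<close>, of which only the restriction to the cube matters.\<close>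

definition L2_cube :: "real \<Rightarrow> (real ^ 3 \<Rightarrow> complex) set" where
  "L2_cube L = {f. f \<in> borel_measurable (lebesgue_on (cube L)) \<and>
                   integrable (lebesgue_on (cube L)) (\<lambda>x. (norm (f x))\<^sup>2)}"

definition symp :: "real \<Rightarrow> (real ^ 3 \<Rightarrow> complex) \<Rightarrow> (real ^ 3 \<Rightarrow> complex) \<Rightarrow> real" where
  "symp L f g = Im (LINT x|lebesgue_on (cube L). cnj (f x) * g x)"

definition fourier_coeff :: "real \<Rightarrow> (real ^ 3 \<Rightarrow> complex) \<Rightarrow> real ^ 3 \<Rightarrow> complex" where
  "fourier_coeff L f k =
     of_real ((2 * pi) powr (- 3 / 2)) * (LINT x|lebesgue_on (cube L). cis (- (k \<bullet> x)) * f x)"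

text \<open>As the chemical potential is strictly negative, the weights are bounded in \<open>k\<close>, so the
  sum is finite on all of \<open>L2_cube L\<close>.\<close>

definition covariance ::
    "real \<Rightarrow> real \<Rightarrow> real \<Rightarrow> real \<Rightarrow> (real ^ 3 \<Rightarrow> complex) \<Rightarrow> real" where
  "covariance s \<beta> \<rho> L f =
     (2 * pi) ^ 3 / vol L *
     (\<Sum>\<^sub>\<infinity>k\<in>momentum_lattice L.
        (1 + exp (- \<beta> * (energy s k - chem_potential s \<beta> \<rho> L))) /
        (1 - exp (- \<beta> * (energy s k - chem_potential s \<beta> \<rho> L))) *
        (norm (fourier_coeff L f k))\<^sup>2)"

section \<open>Regular Weyl systems, fields and resolvents\<close>

text \<open>A complex Hilbert space is encoded as a real Hilbert space with an orthogonal operator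
  \<open>J\<close> (multiplication by the imaginary unit) satisfying \<open>J\<^sup>2 = -1\<close>.  The resulting complex
  inner product is linear in its second argument.\<close>

locale complex_structure =
  fixes J :: "'h::{real_inner, complete_space} \<Rightarrow> 'h"
  assumes linear_J: "linear J"
    and J_J: "J (J x) = - x"
    and inner_J_J: "J x \<bullet> J y = x \<bullet> y"

definition cscale :: "('h \<Rightarrow> 'h) \<Rightarrow> complex \<Rightarrow> 'h \<Rightarrow> 'h::{real_inner, complete_space}" where
  "cscale J c x = Re c *\<^sub>R x + Im c *\<^sub>R J x"

definition cinner :: "('h \<Rightarrow> 'h) \<Rightarrow> 'h::{real_inner, complete_space} \<Rightarrow> 'h \<Rightarrow> complex" where
  "cinner J x y = Complex (x \<bullet> y) (J x \<bullet> y)"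

text \<open>Unitary Weyl operators over \<open>L2_cube L\<close> for which all one-parameter groups
  \<open>t \<mapsto> W (t f)\<close> are strongly continuous.\<close>

locale regular_weyl_system = complex_structure J
  for J :: "'h::{real_inner, complete_space} \<Rightarrow> 'h" +
  fixes L :: real and W :: "(real ^ 3 \<Rightarrow> complex) \<Rightarrow> 'h \<Rightarrow> 'h"
  assumes W_linear: "f \<in> L2_cube L \<Longrightarrow> linear (W f)"
    and W_J: "f \<in> L2_cube L \<Longrightarrow> W f (J x) = J (W f x)"
    and W_isometry: "f \<in> L2_cube L \<Longrightarrow> norm (W f x) = norm x"
    and W_surj: "f \<in> L2_cube L \<Longrightarrow> surj (W f)"
    and W_cong: "\<lbrakk>f \<in> L2_cube L; g \<in> L2_cube L; AE x in lebesgue_on (cube L). f x = g x\<rbrakk>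
      \<Longrightarrow> W f = W g"
    and W_mult: "\<lbrakk>f \<in> L2_cube L; g \<in> L2_cube L\<rbrakk>
      \<Longrightarrow> W f (W g x) = cscale J (cis (- symp L f g / 2)) (W (\<lambda>z. f z + g z) x)"
    and W_regular: "f \<in> L2_cube L \<Longrightarrow> continuous_on UNIV (\<lambda>t::real. W (\<lambda>z. of_real t * f z) x)"

text \<open>The field \<open>\<phi>(f)\<close> is the self-adjoint generator given by \<open>W(t f) = exp (i t \<phi>(f))\<close>,
  on the domain provided by Stone's theorem.\<close>

definition field_domain ::
    "((real ^ 3 \<Rightarrow> complex) \<Rightarrow> 'h \<Rightarrow> 'h) \<Rightarrow> (real ^ 3 \<Rightarrow> complex) \<Rightarrow> 'h::{real_inner, complete_space} set"
  where "field_domain W f = {x. (\<lambda>t::real. W (\<lambda>z. of_real t * f z) x) differentiable (at 0)}"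

definition field_op ::
    "('h \<Rightarrow> 'h) \<Rightarrow> ((real ^ 3 \<Rightarrow> complex) \<Rightarrow> 'h \<Rightarrow> 'h) \<Rightarrow> (real ^ 3 \<Rightarrow> complex)
      \<Rightarrow> 'h \<Rightarrow> 'h::{real_inner, complete_space}"
  where "field_op J W f x =
    - J (vector_derivative (\<lambda>t::real. W (\<lambda>z. of_real t * f z) x) (at 0))"

text \<open>\<open>R(\<lambda>, f) = (i \<lambda> - \<phi>(f))\<^sup>-\<^sup>1\<close>, the inverse being taken on the domain of \<open>\<phi>(f)\<close>.\<close>

definition resolvent_op ::
    "('h \<Rightarrow> 'h) \<Rightarrow> ((real ^ 3 \<Rightarrow> complex) \<Rightarrow> 'h \<Rightarrow> 'h) \<Rightarrow> real \<Rightarrow> (real ^ 3 \<Rightarrow> complex)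
      \<Rightarrow> 'h \<Rightarrow> 'h::{real_inner, complete_space}"
  where "resolvent_op J W l f =
    inv_into (field_domain W f) (\<lambda>x. cscale J (\<i> * of_real l) x - field_op J W f x)"

definition vector_state ::
    "('h \<Rightarrow> 'h) \<Rightarrow> 'h::{real_inner, complete_space} \<Rightarrow> ('h \<Rightarrow> 'h) \<Rightarrow> complex"
  where "vector_state J \<Omega> A = cinner J \<Omega> (A \<Omega>)"

text \<open>The grand canonical state, given by a unit vector in a regular representation with the
  prescribed Gaussian expectations.  The GNS representation is one such realisation; cyclicity
  of the vector is not required.\<close>

locale gibbs_state = regular_weyl_system J L W
  for s \<beta> \<rho> :: real and L :: real and J :: "'h::{real_inner, complete_space} \<Rightarrow> 'h"
    and W :: "(real ^ 3 \<Rightarrow> complex) \<Rightarrow> 'h \<Rightarrow> 'h" +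
  fixes \<Omega> :: 'h
  assumes norm_vec: "norm \<Omega> = 1"
    and quasi_free: "f \<in> L2_cube L
      \<Longrightarrow> vector_state J \<Omega> (W f) = of_real (exp (- covariance s \<beta> \<rho> L f / 4))"

section \<open>Order parameters\<close>

definition zero_mode_fun :: "nat \<Rightarrow> real \<Rightarrow> real ^ 3 \<Rightarrow> complex" where
  "zero_mode_fun n L x = of_real (vol L powr (- (1 + real n) / 2)) * indicator (cube L) x"

definition resolvent_expectation ::
    "nat \<Rightarrow> (real \<Rightarrow> 'h \<Rightarrow> 'h) \<Rightarrow> (real \<Rightarrow> (real ^ 3 \<Rightarrow> complex) \<Rightarrow> 'h \<Rightarrow> 'h)
      \<Rightarrow> (real \<Rightarrow> 'h::{real_inner, complete_space}) \<Rightarrow> real \<Rightarrow> complex"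
  where "resolvent_expectation n J W \<Omega> L =
    \<i> * vector_state (J L) (\<Omega> L) (resolvent_op (J L) (W L) 1 (zero_mode_fun n L))"

text \<open>The limit of the a priori complex numbers \<open>i \<omega>\<^sub>L(R(1, b\<^sub>L))\<close>, when it exists and is real.\<close>

definition order_parameter ::
    "nat \<Rightarrow> (real \<Rightarrow> 'h \<Rightarrow> 'h) \<Rightarrow> (real \<Rightarrow> (real ^ 3 \<Rightarrow> complex) \<Rightarrow> 'h \<Rightarrow> 'h)
      \<Rightarrow> (real \<Rightarrow> 'h::{real_inner, complete_space}) \<Rightarrow> real"
  where "order_parameter n J W \<Omega> =
    (THE r. (resolvent_expectation n J W \<Omega> \<longlongrightarrow> complex_of_real r) at_top)"

end

theory Submission imports Defs begin

text \<open>Put \<open>U(t) = W(-tf)\<close>.  The vector \<open>\<psi> = \<integral>\<^sub>0\<^sup>\<infinity> e\<^sup>-\<^sup>t U(t)\<Omega> dt\<close> satisfies \<open>U'(0)\<psi> = \<psi> - \<Omega>\<close>, so that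
  \<open>R(1,f)\<Omega> = -i\<psi>\<close> and \<open>i \<omega>(R(1,f))\<close> is the integral of \<open>exp (-t - q t\<^sup>2 / 4)\<close> over the half-line,
  where \<open>q\<close> is the covariance of \<open>f\<close>.  This is a continuous function of \<open>q\<close> with value \<open>1\<close> at
  \<open>q = 0\<close>, values strictly between \<open>0\<close> and \<open>1\<close> for \<open>q > 0\<close>, and limit \<open>0\<close> at infinity.  Only the zero
  mode contributes to the covariance of a multiple of the indicator of the cube, which gives
  \<open>q = (1 + 2 N\<^sub>0) / V\<^sup>n\<close> for the two order parameters.

  It remains to find the limits of \<open>N\<^sub>0\<close> and \<open>N\<^sub>0 / V\<close>.  Rounding momenta to the lattice turns the
  lattice sums into integrals of step functions; by dominated convergence the finite volume
  densities converge, for fixed \<open>y > 1\<close>, to the limit density \<open>g(y)\<close>.  Hence \<open>y\<^sub>V\<close> converges to the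
  supremum of \<open>1\<close> and all \<open>y > 1\<close> with \<open>g(y) > \<rho>\<close>.  By Fatou's lemma the limit exceeds \<open>1\<close> exactly if
  \<open>\<rho> < \<rho>\<^sub>c\<close>; otherwise \<open>y\<^sub>V \<rightarrow> 1\<close>, the density of the excited modes tends to \<open>\<rho>\<^sub>c\<close>, again by dominated
  convergence, and the zero mode takes up the remaining density \<open>\<rho> - \<rho>\<^sub>c\<close>.\<close>


section \<open>Integration in complete normed spaces\<close>

text \<open>A type variable of sort \<open>{real_normed_vector, complete_space}\<close> is not recognised as an
  instance of the class \<open>banach\<close> on which the integration theory is based.  The following copy
  of the type is.\<close>

typedef (overloaded) 'a banach_copy = "UNIV :: 'a::{real_normed_vector, complete_space} set"
  morphisms of_copy to_copy ..

setup_lifting type_definition_banach_copy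

instantiation banach_copy :: ("{real_normed_vector, complete_space}") real_normed_vector
begin

lift_definition zero_banach_copy :: "'a banach_copy" is 0 .
lift_definition plus_banach_copy :: "'a banach_copy \<Rightarrow> 'a banach_copy \<Rightarrow> 'a banach_copy" is "(+)" .
lift_definition minus_banach_copy :: "'a banach_copy \<Rightarrow> 'a banach_copy \<Rightarrow> 'a banach_copy" is "(-)" .
lift_definition uminus_banach_copy :: "'a banach_copy \<Rightarrow> 'a banach_copy" is uminus .
lift_definition scaleR_banach_copy :: "real \<Rightarrow> 'a banach_copy \<Rightarrow> 'a banach_copy" is scaleR .
lift_definition norm_banach_copy :: "'a banach_copy \<Rightarrow> real" is norm .

lift_definition dist_banach_copy :: "'a banach_copy \<Rightarrow> 'a banach_copy \<Rightarrow> real" is dist .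
lift_definition sgn_banach_copy :: "'a banach_copy \<Rightarrow> 'a banach_copy" is sgn .

definition uniformity_banach_copy :: "('a banach_copy \<times> 'a banach_copy) filter" where
  "uniformity_banach_copy = (INF e\<in>{0<..}. principal {(x, y). dist x y < e})"
definition open_banach_copy :: "'a banach_copy set \<Rightarrow> bool" where
  "open_banach_copy U \<longleftrightarrow> (\<forall>x\<in>U. \<forall>\<^sub>F (x', y) in uniformity. x' = x \<longrightarrow> y \<in> U)"

instance
proof
  fix x y z :: "'a banach_copy" and a b :: real
  show "x + y + z = x + (y + z)" "a *\<^sub>R (x + y) = a *\<^sub>R x + a *\<^sub>R y"
    "(a + b) *\<^sub>R x = a *\<^sub>R x + b *\<^sub>R x"
    by (transfer; simp add: algebra_simps)+
  show "x + y = y + x" "0 + x = x" "- x + x = 0" "x - y = x + - y" "a *\<^sub>R b *\<^sub>R x = (a * b) *\<^sub>R x"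
    "1 *\<^sub>R x = x" "(norm x = 0) = (x = 0)" "norm (x + y) \<le> norm x + norm y"
    "norm (a *\<^sub>R x) = \<bar>a\<bar> * norm x"
    "dist x y = norm (x - y)" "sgn x = inverse (norm x) *\<^sub>R x"
    by (transfer; simp add: norm_triangle_ineq dist_norm sgn_div_norm)+
qed (rule uniformity_banach_copy_def open_banach_copy_def)+

end

lemma bounded_linear_of_copy: "bounded_linear of_copy"
  by (rule bounded_linear_intro[where K=1]; transfer; simp)

lemma norm_to_copy: "norm (to_copy x) = norm x"
  by transfer simp

lemma to_copy_diff: "to_copy x - to_copy y = to_copy (x - y)"
  by transfer simp

instance banach_copy :: ("{real_normed_vector, complete_space}") banach
proof
  fix X :: "nat \<Rightarrow> 'a banach_copy" assume "Cauchy X"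
  then have "Cauchy (\<lambda>n. of_copy (X n))"
    by (rule bounded_linear.Cauchy[OF bounded_linear_of_copy])
  then obtain l where l: "(\<lambda>n. of_copy (X n)) \<longlonglongrightarrow> l"
    using Cauchy_convergent convergentD by blast
  have "dist (X n) (to_copy l) = dist (of_copy (X n)) l" for n
    using norm_to_copy[of "of_copy (X n) - l"]
    by (simp add: dist_norm of_copy_inverse flip: to_copy_diff)
  then have "X \<longlonglongrightarrow> to_copy l"
    using l by (simp add: lim_sequentially)
  then show "convergent X" by (rule convergentI)
qed

text \<open>The base point of the integral is \<open>-1\<close> in order to have a two-sided derivative at \<open>0\<close>.\<close>

lemma antiderivative_complete_space:
  fixes E :: "real \<Rightarrow> 'a::{real_normed_vector, complete_space}"
  assumes "continuous_on UNIV E"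
  obtains G where "G 0 = 0" "\<And>T. T > -1 \<Longrightarrow> (G has_vector_derivative E T) (at T)"
proof -
  have "continuous_on UNIV (\<lambda>t. to_copy (E t))"
    using assms by (simp add: continuous_on_iff dist_norm to_copy_diff norm_to_copy)
  then have cont: "continuous_on A (\<lambda>t. to_copy (E t))" for A
    by (rule continuous_on_subset) simp
  define I where "I T = integral {-1..T} (\<lambda>t. to_copy (E t))" for T
  have derI: "(I has_vector_derivative to_copy (E T)) (at T)" if "T > -1" for T
  proof -
    have "(I has_vector_derivative to_copy (E T)) (at T within {-1..T+1})"
      unfolding I_def using that by (intro integral_has_vector_derivative cont) auto
    then show ?thesis
      using that by (simp add: at_within_Icc_at)
  qed
  have "((\<lambda>T. of_copy (I T) - of_copy (I 0)) has_vector_derivative E T) (at T)" if "T > -1" for T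
    using bounded_linear.has_vector_derivative[OF bounded_linear_of_copy derI[OF that]]
    by (auto intro!: derivative_eq_intros simp: to_copy_inverse)
  then show thesis by (intro that[of "\<lambda>T. of_copy (I T) - of_copy (I 0)"]) auto
qed

section \<open>Resolvents of the field\<close>

context regular_weyl_system
begin

section \<open>One-parameter groups of Weyl operators\<close>

lemma L2_cube_scale:
  assumes "f \<in> L2_cube L" shows "(\<lambda>z. of_real t * f z) \<in> L2_cube L"
  using assms by (auto simp: L2_cube_def norm_mult power_mult_distrib)

lemma symp_scale_self: "symp L (\<lambda>z. of_real s * f z) (\<lambda>z. of_real t * f z) = 0"
proof -
  have "(\<lambda>x. cnj (of_real s * f x) * (of_real t * f x)) = (\<lambda>x. of_real (s * t * (norm (f x))\<^sup>2))"
    by (rule ext) (simp add: complex_norm_square[symmetric] algebra_simps flip: complex_norm_square)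
  then show ?thesis
    by (simp only: symp_def integral_complex_of_real Im_complex_of_real)
qed

text \<open>The symplectic form vanishes on real multiples of one function, its integrand being a
  real multiple of |f|^2. The Weyl phase is therefore 1.\<close>

lemma W_add_scale:
  assumes "f \<in> L2_cube L"
  shows "W (\<lambda>z. of_real s * f z) (W (\<lambda>z. of_real t * f z) x) = W (\<lambda>z. of_real (s + t) * f z) x"
  using W_mult[OF L2_cube_scale[OF assms, of s] L2_cube_scale[OF assms, of t], of x]
  by (simp only: symp_scale_self) (simp add: cscale_def distrib_right)

lemma bounded_linear_W: "f \<in> L2_cube L \<Longrightarrow> bounded_linear (W f)"
  using W_linear[of f] W_isometry[of f]
  by (intro bounded_linear_intro[where K=1]) (auto simp: linear_add linear_scale)

text \<open>By the group law this operator is idempotent, and it is isometric, hence injective; an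
  injective idempotent is the identity.\<close>

lemma W_scale_0:
  assumes "f \<in> L2_cube L" shows "W (\<lambda>z. of_real 0 * f z) x = x"
proof -
  note f = L2_cube_scale[OF assms, of 0]
  interpret bounded_linear "W (\<lambda>z. of_real 0 * f z)" by (rule bounded_linear_W[OF f])
  let ?W = "W (\<lambda>z. of_real 0 * f z)"
  have "?W (?W x) = ?W x" using W_add_scale[OF assms, of 0 0] by simp
  then have "norm (?W (?W x - x)) = 0" by (simp only: diff) simp
  then show ?thesis by (simp only: W_isometry[OF f]) simp
qed

section \<open>Complex structure and complex inner product\<close>

lemma linear_J_simps:
  "J (x + y) = J x + J y" "J (x - y) = J x - J y" "J (- x) = - J x" "J 0 = 0" "J (c *\<^sub>R x) = c *\<^sub>R J x"
  using linear_J by (auto simp: linear_add linear_diff linear_neg linear_0 linear_scale)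

lemma norm_J: "norm (J x) = norm x"
  by (simp add: norm_eq_sqrt_inner inner_J_J)

lemma bounded_linear_J: "bounded_linear J"
  by (intro bounded_linear_intro[where K=1]) (auto simp: linear_J_simps norm_J)

lemma cinner_J: "cinner J x (J y) = \<i> * cinner J x y"
  using inner_J_J[of x y] inner_J_J[of x "J y"] by (simp add: cinner_def complex_eq_iff J_J)

lemma bounded_linear_cinner: "bounded_linear (cinner J x)"
proof (rule bounded_linear_intro[where K="2 * norm x"])
  fix y
  have "norm (cinner J x y) \<le> \<bar>x \<bullet> y\<bar> + \<bar>J x \<bullet> y\<bar>"
    using cmod_le[of "cinner J x y"] by (simp add: cinner_def)
  also have "\<dots> \<le> norm x * norm y + norm (J x) * norm y"
    by (intro add_mono Cauchy_Schwarz_ineq2)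
  finally show "norm (cinner J x y) \<le> norm y * (2 * norm x)" by (simp add: norm_J algebra_simps)
qed (auto simp: cinner_def inner_add_right complex_eq_iff)

text \<open>The sign makes -i phi(f) the generator, so that the integral of exp(-t) times the flow
  over positive times is the inverse of 1 + i phi(f), which is i R(1,f).\<close>

definition weyl_flow :: "(real ^ 3 \<Rightarrow> complex) \<Rightarrow> real \<Rightarrow> 'h \<Rightarrow> 'h" where
  "weyl_flow f t = W (\<lambda>z. of_real (- t) * f z)"

lemma weyl_flow_add: "f \<in> L2_cube L \<Longrightarrow> weyl_flow f s (weyl_flow f t x) = weyl_flow f (s + t) x"
  unfolding weyl_flow_def by (subst W_add_scale) (simp_all add: algebra_simps)

lemma weyl_flow_0: "f \<in> L2_cube L \<Longrightarrow> weyl_flow f 0 x = x"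
  using W_scale_0[of f x] unfolding weyl_flow_def by simp

lemma bounded_linear_weyl_flow: "f \<in> L2_cube L \<Longrightarrow> bounded_linear (weyl_flow f t)"
  unfolding weyl_flow_def by (intro bounded_linear_W L2_cube_scale)

lemma norm_weyl_flow: "f \<in> L2_cube L \<Longrightarrow> norm (weyl_flow f t x) = norm x"
  unfolding weyl_flow_def by (intro W_isometry L2_cube_scale)

lemma weyl_flow_J: "f \<in> L2_cube L \<Longrightarrow> weyl_flow f t (J x) = J (weyl_flow f t x)"
  unfolding weyl_flow_def by (intro W_J L2_cube_scale)

lemma continuous_weyl_flow:
  assumes "f \<in> L2_cube L" shows "continuous_on A (\<lambda>t. weyl_flow f t x)"
proof -
  have "continuous_on UNIV (\<lambda>t::real. W (\<lambda>z. of_real (- t) * f z) x)"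
    by (rule continuous_on_compose2[OF W_regular[OF assms, of x]]) (auto intro!: continuous_intros)
  then show ?thesis unfolding weyl_flow_def by (rule continuous_on_subset) simp
qed

text \<open>\<open>G T\<close> plays the part of the integral of the weighted flow from 0 to
  \<open>T\<close>, and \<open>\<psi>\<close> that of the integral over the half-line. The last
  identity is the substitution of t + h for t: the weight contributes \<open>exp h\<close>, and the
  piece \<open>G h\<close> between 0 and h drops out. The bound on \<open>h\<close> keeps the
  arguments of \<open>G\<close> above -1.\<close>

lemma weyl_flow_laplace:
  fixes x :: 'h
  assumes f: "f \<in> L2_cube L"
  obtains G \<psi> where
    "\<And>T. T > -1 \<Longrightarrow> (G has_vector_derivative exp (- T) *\<^sub>R weyl_flow f T x) (at T)"
    "G 0 = 0" "(G \<longlongrightarrow> \<psi>) at_top"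
    "\<And>h. \<bar>h\<bar> < 1 \<Longrightarrow> weyl_flow f h \<psi> = exp h *\<^sub>R (\<psi> - G h)"
proof -
  define E where "E t = exp (- t) *\<^sub>R weyl_flow f t x" for t
  have contE: "continuous_on A E" for A
    unfolding E_def by (intro continuous_intros continuous_weyl_flow[OF f])
  obtain G where G0: "G 0 = 0" and derG: "\<And>T. T > -1 \<Longrightarrow> (G has_vector_derivative E T) (at T)"
    using antiderivative_complete_space[OF contE] by blast
  \<comment> \<open>The flow is isometric, so the derivative of \<open>G\<close> has norm |x|
    exp(-t), which is the derivative of -|x| exp(-t). The resulting tail bound makes
    \<open>G\<close> Cauchy at infinity.\<close>
  have Gdiff: "norm (G T - G S) \<le> norm x * (exp (- S) - exp (- T))" if "-1 < S" "S \<le> T" for S T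
  proof -
    have contG: "continuous_on {S..T} G"
      using that by (intro continuous_at_imp_continuous_on ballI has_vector_derivative_continuous[OF derG]) auto
    have "norm (G T - G S) \<le> norm x * - exp (- T) - norm x * - exp (- S)" if "S < T"
      using that \<open>-1 < S\<close>
      by (intro differentiable_bound_general[where f' = E and \<phi>' = "\<lambda>t. norm x * exp (- t)"] contG derG)
        (auto intro!: derivative_eq_intros continuous_intros simp: E_def norm_weyl_flow[OF f]
          simp flip: has_real_derivative_iff_has_vector_derivative)
    then show ?thesis using that by (cases "S = T") (auto simp: algebra_simps)
  qed
  have "cauchy_filter (filtermap G at_top)"
    unfolding cauchy_filter_metric_filtermap
  proof (intro allI impI)
    fix e :: real assume e: "e > 0"
    have "((\<lambda>S. norm x * exp (- S)) \<longlongrightarrow> norm x * 0) at_top"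
      by (intro tendsto_intros filterlim_compose[OF exp_at_bot] filterlim_uminus_at_bot_at_top)
    then have "eventually (\<lambda>S. norm x * exp (- S) < e) at_top"
      using e by (auto dest: order_tendstoD)
    then obtain N where N: "\<And>S. S \<ge> N \<Longrightarrow> norm x * exp (- S) < e"
      by (auto simp: eventually_at_top_linorder)
    have close: "dist (G S) (G T) < e" if "S \<ge> max N 0" "S \<le> T" for S T
    proof -
      have "norm (G T - G S) \<le> norm x * (exp (- S) - exp (- T))"
        using that by (intro Gdiff) auto
      also have "\<dots> \<le> norm x * exp (- S)" by (intro mult_left_mono) auto
      also have "\<dots> < e" using that by (intro N) auto
      finally show ?thesis by (simp add: dist_norm norm_minus_commute)
    qed
    show "\<exists>P. eventually P at_top \<and> (\<forall>S T. P S \<and> P T \<longrightarrow> dist (G S) (G T) < e)"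
    proof (intro exI[of _ "\<lambda>S. S \<ge> max N 0"] conjI allI impI)
      fix S T :: real assume "S \<ge> max N 0 \<and> T \<ge> max N 0"
      then show "dist (G S) (G T) < e"
        using close[of S T] close[of T S] by (cases "S \<le> T") (auto simp: dist_commute)
    qed (rule eventually_ge_at_top)
  qed
  then obtain \<psi> where "filtermap G at_top \<le> nhds \<psi>"
    using cauchy_filter_complete_converges[of "filtermap G at_top" UNIV] complete_UNIV
    by (auto simp: filtermap_bot_iff)
  then have lim: "(G \<longlongrightarrow> \<psi>) at_top" by (simp add: filterlim_def)
  have flow: "weyl_flow f h \<psi> = exp h *\<^sub>R (\<psi> - G h)" if h: "\<bar>h\<bar> < 1" for h
  proof -
    interpret U: bounded_linear "weyl_flow f h" by (rule bounded_linear_weyl_flow[OF f])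
    \<comment> \<open>The shift formula for a finite upper limit: the difference \<open>D\<close> of
      the two sides vanishes at 0 and has derivative 0 by the group law.\<close>
    have eq: "weyl_flow f h (G T) = exp h *\<^sub>R (G (T + h) - G h)" if T: "T \<ge> 0" for T
    proof -
      define D where "D T = weyl_flow f h (G T) - exp h *\<^sub>R (G (T + h) - G h)" for T
      have "(D has_vector_derivative 0) (at t)" if "t \<ge> 0" for t
      proof -
        have "(D has_vector_derivative weyl_flow f h (E t) - exp h *\<^sub>R E (t + h)) (at t)"
        proof -
          have 1: "((\<lambda>T. G (T + h)) has_vector_derivative 1 *\<^sub>R E (t + h)) (at t)"
            by (rule vector_diff_chain_at[of "\<lambda>T. T + h" 1 t G, unfolded o_def])
              (use h that in \<open>auto intro!: derivative_eq_intros derG\<close>)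
          have 2: "((\<lambda>T. weyl_flow f h (G T)) has_vector_derivative weyl_flow f h (E t)) (at t)"
            using that by (intro U.has_vector_derivative derG) auto
          show ?thesis unfolding D_def using 1 2 by (auto intro!: derivative_eq_intros)
        qed
        then show ?thesis
          by (simp add: E_def U.scaleR weyl_flow_add[OF f] add.commute flip: exp_add)
      qed
      then have "D T = D 0"
        using has_vector_derivative_zero_constant[of "{0..}" D] T
        by (metis atLeast_iff convex_real_interval(1) has_vector_derivative_at_within order_refl)
      then show ?thesis by (simp add: D_def G0 U.zero)
    qed
    have shift: "filterlim (\<lambda>T. T + h) at_top at_top"
      using filterlim_tendsto_add_at_top[OF tendsto_const filterlim_ident, of h] by (simp add: add.commute)
    have lim1: "((\<lambda>T. weyl_flow f h (G T)) \<longlongrightarrow> weyl_flow f h \<psi>) at_top"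
      by (rule U.tendsto[OF lim])
    have lim2: "((\<lambda>T. exp h *\<^sub>R (G (T + h) - G h)) \<longlongrightarrow> exp h *\<^sub>R (\<psi> - G h)) at_top"
      by (intro tendsto_intros filterlim_compose[OF lim] shift)
    have "eventually (\<lambda>T. exp h *\<^sub>R (G (T + h) - G h) = weyl_flow f h (G T)) at_top"
      using eventually_ge_at_top[of 0] by eventually_elim (rule eq[symmetric])
    from tendsto_unique[OF trivial_limit_at_top_linorder lim1 Lim_transform_eventually[OF lim2 this]]
    show ?thesis .
  qed
  show thesis by (rule that[of G \<psi>]) (use derG G0 lim flow in \<open>auto simp: E_def\<close>)
qed

section \<open>The field as generator of the flow, and its resolvent\<close>

lemma vector_derivative_W_iff:
  "((\<lambda>t::real. W (\<lambda>z. of_real t * f z) x) has_vector_derivative - v) (at 0)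
    \<longleftrightarrow> ((\<lambda>t. weyl_flow f t x) has_vector_derivative v) (at 0)"
proof
  assume "((\<lambda>t::real. W (\<lambda>z. of_real t * f z) x) has_vector_derivative - v) (at 0)"
  then have "((\<lambda>t::real. W (\<lambda>z. of_real t * f z) x) \<circ> uminus has_vector_derivative (-1) *\<^sub>R (- v)) (at 0)"
    by (intro vector_diff_chain_at) (auto intro!: derivative_eq_intros)
  then show "((\<lambda>t. weyl_flow f t x) has_vector_derivative v) (at 0)"
    by (simp add: o_def weyl_flow_def)
next
  assume "((\<lambda>t. weyl_flow f t x) has_vector_derivative v) (at 0)"
  then have "((\<lambda>t. weyl_flow f t x) \<circ> uminus has_vector_derivative (-1) *\<^sub>R v) (at 0)"
    by (intro vector_diff_chain_at) (auto intro!: derivative_eq_intros)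
  then show "((\<lambda>t::real. W (\<lambda>z. of_real t * f z) x) has_vector_derivative - v) (at 0)"
    by (simp add: o_def weyl_flow_def)
qed

text \<open>The field is defined by the forward group, whose derivative is \<open>- v\<close>; the
  two signs cancel in \<open>- J (- v)\<close>.\<close>

lemma field_op_flow:
  assumes "((\<lambda>t. weyl_flow f t x) has_vector_derivative v) (at 0)"
  shows "x \<in> field_domain W f" "field_op J W f x = J v"
proof -
  have *: "((\<lambda>t::real. W (\<lambda>z. of_real t * f z) x) has_vector_derivative - v) (at 0)"
    using assms by (simp only: vector_derivative_W_iff)
  then show "x \<in> field_domain W f"
    unfolding field_domain_def using differentiableI_vector by blast
  show "field_op J W f x = J v"
    using vector_derivative_at[OF *] by (simp add: field_op_def linear_J_simps)
qed

lemma field_domain_flow: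
  assumes "x \<in> field_domain W f"
  obtains v where "((\<lambda>t. weyl_flow f t x) has_vector_derivative v) (at 0)"
proof -
  from assms obtain w where "((\<lambda>t::real. W (\<lambda>z. of_real t * f z) x) has_vector_derivative w) (at 0)"
    unfolding field_domain_def using vector_derivative_works by blast
  then show thesis using that[of "- w"] vector_derivative_W_iff[of f x "- w"] by simp
qed

text \<open>On \<open>- J \<psi>\<close> the field takes the value \<open>\<psi> - x\<close> and
  multiplication by i gives \<open>\<psi>\<close>, so i - phi(f) maps this vector to
  \<open>x\<close>. The resolvent being an \<open>inv_into\<close>, injectivity on the domain has to
  be shown as well.\<close>

lemma resolvent_op_eqI:
  assumes f: "f \<in> L2_cube L"
    and \<psi>: "((\<lambda>t. weyl_flow f t \<psi>) has_vector_derivative \<psi> - x) (at 0)"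
  shows "resolvent_op J W 1 f x = - J \<psi>"
proof -
  let ?A = "\<lambda>x. cscale J (\<i> * of_real 1) x - field_op J W f x"
  have J\<psi>: "((\<lambda>t. weyl_flow f t (- J \<psi>)) has_vector_derivative - J (\<psi> - x)) (at 0)"
  proof -
    have "((\<lambda>t. - J (weyl_flow f t \<psi>)) has_vector_derivative - J (\<psi> - x)) (at 0)"
      by (intro has_vector_derivative_minus bounded_linear.has_vector_derivative[OF bounded_linear_J] \<psi>)
    moreover have "weyl_flow f t (- J \<psi>) = - J (weyl_flow f t \<psi>)" for t
      by (simp add: weyl_flow_J[OF f]
          linear_neg[OF bounded_linear.linear[OF bounded_linear_weyl_flow[OF f]]])
    ultimately show ?thesis by simp
  qed
  have dom: "- J \<psi> \<in> field_domain W f" and val: "?A (- J \<psi>) = x"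
    using field_op_flow[OF J\<psi>] by (simp_all add: cscale_def linear_J_simps J_J)
  have inj: "inj_on ?A (field_domain W f)"
  proof (rule inj_onI)
    fix a b assume a: "a \<in> field_domain W f" and b: "b \<in> field_domain W f" and eq: "?A a = ?A b"
    from a obtain va where va: "((\<lambda>t. weyl_flow f t a) has_vector_derivative va) (at 0)"
      by (rule field_domain_flow)
    from b obtain vb where vb: "((\<lambda>t. weyl_flow f t b) has_vector_derivative vb) (at 0)"
      by (rule field_domain_flow)
    have "J a - J va = J b - J vb"
      using eq field_op_flow(2)[OF va] field_op_flow(2)[OF vb] by (simp add: cscale_def)
    then have "J (J a - J va) = J (J b - J vb)" by simp
    then have "a - va = b - vb" by (simp add: linear_J_simps J_J algebra_simps)
    then have v: "va - vb = a - b" by (simp add: algebra_simps)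
    \<comment> \<open>For two preimages of one vector, u'(0) = u(0), so the squared norm of
      \<open>u\<close> has derivative 2 |a - b|^2 at 0. The flow preserves the norm, so this
      derivative is 0.\<close>
    define u where "u t = weyl_flow f t (a - b)" for t
    have der0: "(u has_vector_derivative (a - b)) (at 0)"
    proof -
      have "u = (\<lambda>t. weyl_flow f t a - weyl_flow f t b)"
        unfolding u_def by (intro ext linear_diff[OF bounded_linear.linear[OF bounded_linear_weyl_flow[OF f]]])
      then show ?thesis using has_vector_derivative_diff[OF va vb] v by simp
    qed
    have "((\<lambda>t. u t \<bullet> u t) has_vector_derivative ((a - b) \<bullet> u 0 + u 0 \<bullet> (a - b))) (at 0)"
      using der0 unfolding has_vector_derivative_def
      by (auto intro!: derivative_eq_intros simp: algebra_simps)
    moreover have "(\<lambda>t. u t \<bullet> u t) = (\<lambda>t. (norm (a - b))\<^sup>2)"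
      by (simp add: u_def power2_norm_eq_inner[symmetric] norm_weyl_flow[OF f])
    ultimately have "((\<lambda>t::real. (norm (a - b))\<^sup>2) has_vector_derivative ((a - b) \<bullet> u 0 + u 0 \<bullet> (a - b))) (at 0)"
      by simp
    then have "(a - b) \<bullet> u 0 + u 0 \<bullet> (a - b) = 0"
      using has_vector_derivative_const vector_derivative_unique_at by blast
    then show "a = b" by (simp add: u_def weyl_flow_0[OF f])
  qed
  have "inv_into (field_domain W f) ?A (?A (- J \<psi>)) = - J \<psi>"
    by (rule inv_into_f_f[OF inj dom])
  then show ?thesis unfolding resolvent_op_def val .
qed

end

section \<open>The Laplace transform of a Gaussian\<close>

definition laplace_gauss :: "real \<Rightarrow> real" where
  "laplace_gauss q = (LINT t|lborel. indicator {0..} t * exp (- t - q * t\<^sup>2 / 4))"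

lemma exp_minus_half_line:
  "integrable lborel (\<lambda>t::real. indicator {0..} t * exp (- t))"
  "(LINT t|lborel. indicator {0..} t * exp (- t::real)) = 1"
proof -
  have "((\<lambda>t::real. exp (- t)) has_integral 1) {0..}"
    using has_integral_exp_minus_to_infinity[of 1 0] by simp
  moreover have "((\<lambda>t::real. exp (- t)) absolutely_integrable_on {0..})"
    using calculation by (intro nonnegative_absolutely_integrable_1) auto
  ultimately have "set_integrable lebesgue {0..} (\<lambda>t::real. exp (- t))"
    "(LINT t:{0..}|lebesgue. exp (- t::real)) = 1"
    by (auto simp: set_lebesgue_integral_eq_integral(2) integral_unique)
  then show "integrable lborel (\<lambda>t::real. indicator {0..} t * exp (- t))"
    "(LINT t|lborel. indicator {0..} t * exp (- t::real)) = 1"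
    by (simp_all add: set_integrable_def set_lebesgue_integral_def integrable_completion integral_completion)
qed

lemma laplace_gauss_le: "q \<ge> 0 \<Longrightarrow> indicator {0..} t * exp (- t - q * t\<^sup>2 / 4) \<le> indicator {0..} t * exp (- t::real)"
  by (intro mult_left_mono) auto

lemma integrable_laplace_gauss:
  assumes "q \<ge> 0"
  shows "integrable lborel (\<lambda>t::real. indicator {0..} t * exp (- t - q * t\<^sup>2 / 4))"
  by (rule Bochner_Integration.integrable_bound[OF exp_minus_half_line(1)])
    (use laplace_gauss_le[OF assms] in auto)

lemma laplace_gauss_0: "laplace_gauss 0 = 1"
  by (simp add: laplace_gauss_def exp_minus_half_line)

lemma laplace_gauss_le_1: "q \<ge> 0 \<Longrightarrow> laplace_gauss q \<le> 1"
  unfolding laplace_gauss_def exp_minus_half_line(2)[symmetric]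
  by (intro integral_mono integrable_laplace_gauss exp_minus_half_line(1) laplace_gauss_le)

lemma laplace_gauss_pos:
  assumes "q \<ge> 0" shows "laplace_gauss q > 0"
proof -
  \<comment> \<open>On [0,1] both t and t^2 are at most 1, which gives a constant lower bound of the
    integrand.\<close>
  have "0 < (LINT (t::real)|lborel. indicator {0..1} t * exp (- 1 - q / 4))" by simp
  also have "\<dots> \<le> laplace_gauss q"
    unfolding laplace_gauss_def
  proof (intro integral_mono integrable_laplace_gauss assms)
    show "indicator {0..1} t * exp (- 1 - q / 4) \<le> indicator {0..} t * exp (- t - q * t\<^sup>2 / 4)" for t
      using assms power_le_one[of t 2] mult_left_le[of "t\<^sup>2" q] by (auto simp: indicator_def)
  qed simp
  finally show ?thesis .
qed

lemma laplace_gauss_less_1: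
  assumes "q > 0" shows "laplace_gauss q < 1"
proof -
  \<comment> \<open>The gap between the integrands is exp(-t) (1 - exp(-q t^2 / 4)). On [1,2] the
    first factor is smallest at t = 2, the second at t = 1.\<close>
  have "0 < (LINT (t::real)|lborel. indicator {1..2} t * (exp (- 2) * (1 - exp (- q / 4))))"
    using assms by simp
  also have "\<dots> \<le> (LINT t|lborel. indicator {0..} t * exp (- t) - indicator {0..} t * exp (- t - q * t\<^sup>2 / 4))"
  proof (intro integral_mono Bochner_Integration.integrable_diff integrable_laplace_gauss exp_minus_half_line)
    fix t :: real
    show "indicator {1..2} t * (exp (- 2) * (1 - exp (- q / 4)))
        \<le> indicator {0..} t * exp (- t) - indicator {0..} t * exp (- t - q * t\<^sup>2 / 4)"
    proof (cases "t \<in> {1..2}")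
      case True
      then have "exp (- 2) * (1 - exp (- q / 4)) \<le> exp (- t) * (1 - exp (- q * t\<^sup>2 / 4))"
        using assms by (intro mult_mono) (auto simp: one_le_power)
      also have "\<dots> = exp (- t) - exp (- t - q * t\<^sup>2 / 4)"
        by (simp add: right_diff_distrib flip: exp_add)
      finally show ?thesis using True by simp
    next
      case False
      then show ?thesis using laplace_gauss_le[of q t] assms by simp
    qed
  qed (use assms in auto)
  also have "\<dots> = 1 - laplace_gauss q"
    using assms unfolding laplace_gauss_def
    by (subst Bochner_Integration.integral_diff)
      (auto intro: integrable_laplace_gauss exp_minus_half_line(1) simp: exp_minus_half_line(2))
  finally show ?thesis by simp
qed

text \<open>Dominated convergence; the majorant exp(-t) serves all nonnegative \<open>q\<close> at
  once.\<close>

lemma tendsto_laplace_gauss: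
  assumes "(q \<longlongrightarrow> q0) at_top" "eventually (\<lambda>L. q L \<ge> 0) at_top"
  shows "((\<lambda>L::real. laplace_gauss (q L)) \<longlongrightarrow> laplace_gauss q0) at_top"
  unfolding laplace_gauss_def
proof (rule integral_dominated_convergence_at_top[OF _ _ exp_minus_half_line(1)])
  show "\<forall>\<^sub>F L in at_top. AE t in lborel. norm (indicator {0..} t * exp (- t - q L * t\<^sup>2 / 4))
      \<le> indicator {0..} t * exp (- t)"
    using assms(2) by eventually_elim (use laplace_gauss_le in auto)
qed (use assms in \<open>auto intro!: tendsto_intros\<close>)

lemma tendsto_laplace_gauss_at_top:
  assumes "filterlim q at_top at_top"
  shows "((\<lambda>L::real. laplace_gauss (q L)) \<longlongrightarrow> 0) at_top"
proof -
  have "((\<lambda>L. laplace_gauss (q L)) \<longlongrightarrow> (LINT (t::real)|lborel. (0::real))) at_top"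
    unfolding laplace_gauss_def
  proof (rule integral_dominated_convergence_at_top[OF _ _ exp_minus_half_line(1)])
    have "eventually (\<lambda>L. q L \<ge> 0) at_top"
      using assms by (simp add: filterlim_at_top)
    then show "\<forall>\<^sub>F L in at_top. AE t in lborel. norm (indicator {0..} t * exp (- t - q L * t\<^sup>2 / 4))
        \<le> indicator {0..} t * exp (- t)"
      by eventually_elim (use laplace_gauss_le in auto)
    \<comment> \<open>The point t = 0 is left out, since the integrand is 1 there for every
      \<open>L\<close>.\<close>
    show "AE t in lborel. ((\<lambda>L. indicator {0..} t * exp (- t - q L * t\<^sup>2 / 4)) \<longlongrightarrow> (0::real)) at_top"
      using AE_lborel_singleton[of 0]
    proof eventually_elim
      case (elim t)
      have "filterlim (\<lambda>L. t\<^sup>2 / 4 * q L) at_top at_top"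
        using elim by (intro filterlim_tendsto_pos_mult_at_top[OF tendsto_const _ assms]) auto
      then have "filterlim (\<lambda>L. t + t\<^sup>2 / 4 * q L) at_top at_top"
        by (rule filterlim_tendsto_add_at_top[OF tendsto_const])
      then have "((\<lambda>L. exp (- (t + t\<^sup>2 / 4 * q L))) \<longlongrightarrow> 0) at_top"
        by (intro filterlim_compose[OF exp_at_bot]) (simp add: filterlim_uminus_at_bot add.commute)
      then have "((\<lambda>L. exp (- t - q L * t\<^sup>2 / 4)) \<longlongrightarrow> 0) at_top"
        by (simp add: algebra_simps)
      then show ?case by (rule tendsto_mult_right_zero)
    qed
  qed auto
  then show ?thesis by simp
qed

text \<open>Passes to gauge integrals over bounded intervals, the form in which the fundamental
  theorem of calculus supplies the expectations of \<open>G T\<close>.\<close>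

lemma laplace_gauss_limit:
  assumes "q \<ge> 0"
  shows "((\<lambda>T. integral {0..T} (\<lambda>t. exp (- t - q * t\<^sup>2 / 4))) \<longlongrightarrow> laplace_gauss q) at_top"
proof -
  have "((\<lambda>T. LINT t|lborel. indicator {..T} t *\<^sub>R (indicator {0..} t * exp (- t - q * t\<^sup>2 / 4)))
      \<longlongrightarrow> laplace_gauss q) at_top"
    unfolding laplace_gauss_def
    by (rule tendsto_integral_at_top[OF _ integrable_laplace_gauss[OF assms]]) simp
  moreover have "(LINT t|lborel. indicator {..T} t *\<^sub>R (indicator {0..} t * exp (- t - q * t\<^sup>2 / 4)))
      = integral {0..T} (\<lambda>t. exp (- t - q * t\<^sup>2 / 4))" for T
  proof -
    have "(LINT t|lborel. indicator {..T} t *\<^sub>R (indicator {0..} t * exp (- t - q * t\<^sup>2 / 4)))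
       = (LINT t:{0..T}|lborel. exp (- t - q * t\<^sup>2 / 4))"
      unfolding set_lebesgue_integral_def by (rule Bochner_Integration.integral_cong) (auto simp: indicator_def)
    also have "\<dots> = integral {0..T} (\<lambda>t. exp (- t - q * t\<^sup>2 / 4))"
      by (intro set_borel_integral_eq_integral borel_integrable_atLeastAtMost') (auto intro!: continuous_intros)
    finally show ?thesis .
  qed
  ultimately show ?thesis by simp
qed

section \<open>Resolvent expectations as Laplace integrals\<close>

context gibbs_state
begin

text \<open>Pairing the Laplace integral of the flow with the state vector turns it into the Laplace
  integral of the Weyl expectations. Homogeneity of the covariance along the multiples of
  \<open>f\<close> makes these Gaussian in t.\<close>

lemma expectation_resolvent:
  assumes f: "f \<in> L2_cube L"
    and q: "\<And>t. covariance s \<beta> \<rho> L (\<lambda>z. of_real t * f z) = t\<^sup>2 * q" "q \<ge> 0"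
  shows "\<i> * vector_state J \<Omega> (resolvent_op J W 1 f) = of_real (laplace_gauss q)"
proof -
  obtain G \<psi> where derG: "\<And>T. T > -1 \<Longrightarrow> (G has_vector_derivative exp (- T) *\<^sub>R weyl_flow f T \<Omega>) (at T)"
    and G0: "G 0 = 0" and lim: "(G \<longlongrightarrow> \<psi>) at_top"
    and flow: "\<And>h. \<bar>h\<bar> < 1 \<Longrightarrow> weyl_flow f h \<psi> = exp h *\<^sub>R (\<psi> - G h)"
    by (rule weyl_flow_laplace[OF f, of \<Omega>]) blast
  interpret C: bounded_linear "cinner J \<Omega>" by (rule bounded_linear_cinner)
  \<comment> \<open>As \<open>G 0 = 0\<close> and \<open>G\<close> has derivative
    \<open>\<Omega>\<close> at 0, the product rule yields the hypothesis of
    \<open>resolvent_op_eqI\<close>.\<close>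
  have "((\<lambda>h. exp h *\<^sub>R (\<psi> - G h)) has_vector_derivative (\<psi> - \<Omega>)) (at 0)"
    using derG[of 0] by (auto intro!: derivative_eq_intros simp: G0 weyl_flow_0[OF f])
  then have "((\<lambda>t. weyl_flow f t \<psi>) has_vector_derivative \<psi> - \<Omega>) (at 0)"
    by (rule has_vector_derivative_transform_within_open[where S = "{-1<..<1}"]) (auto simp: flow)
  then have res: "resolvent_op J W 1 f \<Omega> = - J \<psi>"
    by (rule resolvent_op_eqI[OF f])
  have exp_flow: "cinner J \<Omega> (weyl_flow f t \<Omega>) = of_real (exp (- (t\<^sup>2 * q) / 4))" for t
    using quasi_free[OF L2_cube_scale[OF f, of "- t"]] q(1)[of "- t"]
    by (simp add: vector_state_def weyl_flow_def)
  have "cinner J \<Omega> (G T) = of_real (integral {0..T} (\<lambda>t. exp (- t - q * t\<^sup>2 / 4)))" if "T \<ge> 0" for T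
  proof -
    have "((\<lambda>t. of_real (exp (- t - q * t\<^sup>2 / 4))) has_integral (cinner J \<Omega> (G T) - cinner J \<Omega> (G 0))) {0..T}"
    proof (rule fundamental_theorem_of_calculus[OF that])
      fix t assume "t \<in> {0..T}"
      then have "((\<lambda>T. cinner J \<Omega> (G T)) has_vector_derivative cinner J \<Omega> (exp (- t) *\<^sub>R weyl_flow f t \<Omega>)) (at t)"
        by (intro C.has_vector_derivative derG) auto
      moreover have "cinner J \<Omega> (exp (- t) *\<^sub>R weyl_flow f t \<Omega>) = of_real (exp (- t - q * t\<^sup>2 / 4))"
        by (simp add: C.scaleR exp_flow scaleR_conv_of_real mult.commute flip: of_real_mult exp_add)
      ultimately show "((\<lambda>T. cinner J \<Omega> (G T)) has_vector_derivative of_real (exp (- t - q * t\<^sup>2 / 4))) (at t within {0..T})"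
        by (simp add: has_vector_derivative_at_within)
    qed
    moreover have "((\<lambda>t. complex_of_real (exp (- t - q * t\<^sup>2 / 4))) has_integral
        of_real (integral {0..T} (\<lambda>t. exp (- t - q * t\<^sup>2 / 4)))) {0..T}"
      by (intro has_integral_of_real integrable_integral integrable_continuous_real continuous_intros) auto
    ultimately have "cinner J \<Omega> (G T) - cinner J \<Omega> (G 0)
        = of_real (integral {0..T} (\<lambda>t. exp (- t - q * t\<^sup>2 / 4)))"
      by (rule has_integral_unique)
    then show ?thesis by (simp add: G0 C.zero)
  qed
  then have "((\<lambda>T. of_real (integral {0..T} (\<lambda>t. exp (- t - q * t\<^sup>2 / 4)))) \<longlongrightarrow> cinner J \<Omega> \<psi>) at_top"
    using C.tendsto[OF lim] by (rule_tac Lim_transform_eventually) (auto intro: eventually_at_top_linorderI[of 0])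
  moreover have "((\<lambda>T. of_real (integral {0..T} (\<lambda>t. exp (- t - q * t\<^sup>2 / 4)))) \<longlongrightarrow> complex_of_real (laplace_gauss q)) at_top"
    by (intro tendsto_of_real laplace_gauss_limit q(2))
  ultimately have "cinner J \<Omega> \<psi> = of_real (laplace_gauss q)"
    by (rule tendsto_unique[rotated]) simp
  moreover have "cinner J \<Omega> (- J \<psi>) = - \<i> * cinner J \<Omega> \<psi>"
    using linear_neg[OF C.linear, of "J \<psi>"] cinner_J[of \<Omega> \<psi>] by simp
  ultimately show ?thesis by (simp add: vector_state_def res)
qed

end

section \<open>Covariance of the zero mode\<close>

text \<open>Lebesgue measure is the image of the product of its one-dimensional copies under the
  coordinate map, so Fubini's theorem applies.\<close>

lemma integral_lborel_prod:
  fixes g :: "'a::euclidean_space \<Rightarrow> real \<Rightarrow> 'b::{real_normed_field, banach, second_countable_topology}"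
  assumes "\<And>b. b \<in> Basis \<Longrightarrow> integrable lborel (g b)"
  shows "(LINT x|lborel. (\<Prod>b\<in>Basis. g b (x \<bullet> b))) = (\<Prod>b\<in>Basis. LINT t|lborel. g b t)"
proof -
  interpret product_sigma_finite "\<lambda>_::'a. lborel :: real measure" ..
  have [measurable]: "g b \<in> borel_measurable borel" if "b \<in> Basis" for b
    using borel_measurable_integrable[OF assms[OF that]] by simp
  have "(LINT x|lborel. (\<Prod>b\<in>Basis. g b (x \<bullet> b)))
      = (LINT f|(\<Pi>\<^sub>M b\<in>Basis. lborel). (\<Prod>b\<in>Basis. g b ((\<Sum>b\<in>Basis. f b *\<^sub>R b) \<bullet> b)))"
    by (subst lborel_eq, subst integral_distr) auto
  also have "\<dots> = (LINT f|(\<Pi>\<^sub>M b\<in>Basis. lborel). (\<Prod>b\<in>Basis. g b (f b)))"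
    by (simp add: inner_sum_left_Basis)
  also have "\<dots> = (\<Prod>b\<in>Basis. LINT t|lborel. g b t)"
    by (rule product_integral_prod[OF finite_Basis assms])
  finally show ?thesis .
qed

text \<open>At a lattice frequency, a L / 2 is an integer multiple of pi, so the antiderivative
  takes the same value at both ends.\<close>

lemma integral_cis_interval:
  fixes a L :: real
  assumes "a \<noteq> 0" "L > 0" "a = 2 * pi / L * of_int n"
  shows "(LINT t|lborel. of_real (indicator {- L / 2..L / 2} t) * cis (- (a * t))) = 0"
proof -
  define F where "F t = cis (- (a * t)) / (- \<i> * of_real a)" for t
  have der: "(F has_vector_derivative cis (- (a * t))) (at t within A)" for t A
  proof -
    have "((\<lambda>t. exp (- \<i> * of_real a * t) / (- \<i> * of_real a)) has_field_derivative exp (- \<i> * of_real a * of_real t)) (at (of_real t))"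
      using assms(1) by (auto intro!: derivative_eq_intros simp: field_simps)
    then have "((\<lambda>t. exp (- \<i> * of_real a * of_real t) / (- \<i> * of_real a)) has_vector_derivative exp (- \<i> * of_real a * of_real t)) (at t within A)"
      by (rule has_vector_derivative_real_field[OF has_field_derivative_at_within])
    then show ?thesis by (simp add: F_def[abs_def] cis_conv_exp mult.assoc)
  qed
  have "(LINT t|lborel. indicator {- L / 2..L / 2} t *\<^sub>R cis (- (a * t))) = F (L / 2) - F (- L / 2)"
    using assms(2) by (intro integral_FTC_Icc der continuous_intros) auto
  also have "a * (L / 2) = pi * of_int n" using assms by simp
  then have "cis (- (a * (L / 2))) = cis (a * (L / 2))"
    by (intro complex_eqI) (auto simp: sin_int_times_real mult.commute)
  then have "F (L / 2) - F (- L / 2) = 0"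
    by (simp add: F_def)
  finally show ?thesis by (simp add: scaleR_conv_of_real)
qed

lemma mem_cube_iff: "x \<in> cube L \<longleftrightarrow> (\<forall>b\<in>Basis. x \<bullet> b \<in> {- L / 2..L / 2})"
proof -
  have "(\<chi> i. c) \<bullet> b = c" if "b \<in> Basis" for c :: real and b :: "real ^ 3"
    using that by (auto simp: Basis_vec_def inner_axis)
  then show ?thesis by (auto simp: cube_def mem_box)
qed

lemma cube_sets [measurable]: "cube L \<in> sets borel"
  by (simp add: cube_def)

lemma cube_sets_lebesgue [measurable]: "cube L \<in> sets lebesgue"
  by (simp add: cube_def)

lemma measure_cube: "L > 0 \<Longrightarrow> measure lborel (cube L) = vol L"
  unfolding cube_def vol_def by (subst content_cbox_cart) (auto simp: interval_ne_empty_cart)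

text \<open>Orthogonality of plane waves: the integral factorizes over the coordinates, and a
  nonzero component of \<open>k\<close> makes its factor vanish.\<close>

lemma integral_cube_cis:
  assumes "L > 0" "k \<in> momentum_lattice L"
  shows "(LINT x|lborel. of_real (indicator (cube L) x) * cis (- (k \<bullet> x))) = of_real (if k = 0 then vol L else 0)"
proof (cases "k = 0")
  case True
  then show ?thesis using measure_cube[OF assms(1)] by simp
next
  case False
  define g where "g b t = of_real (indicator {- L / 2..L / 2} t) * cis (- (k \<bullet> b * t))" for b :: "real ^ 3" and t :: real
  have eq: "of_real (indicator (cube L) x) * cis (- (k \<bullet> x)) = (\<Prod>b\<in>Basis. g b (x \<bullet> b))" for x
  proof -
    have "(\<Prod>b\<in>Basis. of_real (indicator {- L / 2..L / 2} (x \<bullet> b))) = (of_real (indicator (cube L) x) :: complex)"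
      by (auto simp: indicator_def mem_cube_iff)
    moreover have "(\<Prod>b\<in>Basis. cis (- (k \<bullet> b * (x \<bullet> b)))) = cis (- (k \<bullet> x))"
      by (simp add: euclidean_inner[of k x] cis_conv_exp exp_sum sum_distrib_left flip: sum_negf)
    ultimately show ?thesis by (simp add: g_def prod.distrib)
  qed
  have int: "integrable lborel (g b)" for b
  proof -
    have "set_integrable lborel {- L / 2..L / 2} (\<lambda>t. cis (- (k \<bullet> b * t)))"
      by (intro borel_integrable_atLeastAtMost' continuous_intros)
    then show ?thesis by (simp add: g_def[abs_def] set_integrable_def scaleR_conv_of_real)
  qed
  obtain b where b: "b \<in> Basis" "k \<bullet> b \<noteq> 0"
    using False euclidean_all_zero_iff by blast
  obtain i where "b = axis i 1"
    using b(1) by (auto simp: Basis_vec_def)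
  then obtain n :: int where "k \<bullet> b = 2 * pi / L * of_int n"
    using assms(2) unfolding momentum_lattice_def by (auto simp: inner_axis)
  then have "(LINT t|lborel. g b t) = 0"
    unfolding g_def by (rule integral_cis_interval[OF b(2) assms(1)])
  then have "(\<Prod>b\<in>Basis. LINT t|lborel. g b t) = 0"
    using b(1) by (intro prod_zero) auto
  then show ?thesis
    using False by (simp only: eq integral_lborel_prod[OF int]) simp
qed

section \<open>Fourier coefficients and covariance of multiples of the indicator of the cube\<close>

lemma fourier_coeff_cube:
  assumes "L > 0" "k \<in> momentum_lattice L"
  shows "fourier_coeff L (\<lambda>x. a * indicator (cube L) x) k
    = of_real ((2 * pi) powr (- 3 / 2)) * a * of_real (if k = 0 then vol L else 0)"
proof -
  have "(LINT x|lebesgue_on (cube L). cis (- (k \<bullet> x)) * (a * indicator (cube L) x))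
      = (LINT x|lebesgue_on (cube L). a * cis (- (k \<bullet> x)))"
    by (rule Bochner_Integration.integral_cong) auto
  also have "\<dots> = (LINT x|lebesgue. indicator (cube L) x *\<^sub>R (a * cis (- (k \<bullet> x))))"
    by (subst integral_restrict_space) auto
  also have "\<dots> = (LINT x|lborel. a * (of_real (indicator (cube L) x) * cis (- (k \<bullet> x))))"
    by (subst integral_completion) (auto simp: scaleR_conv_of_real algebra_simps
        intro!: borel_measurable_times borel_measurable_continuous_onI[of "\<lambda>x. cis (- (k \<bullet> x))"] continuous_intros)
  also have "\<dots> = a * of_real (if k = 0 then vol L else 0)"
    using integral_cube_cis[OF assms] by (simp add: integral_mult_right_zero)
  finally show ?thesis unfolding fourier_coeff_def by (simp only: mult.assoc)
qed

lemma zero_in_momentum_lattice: "0 \<in> momentum_lattice L"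
  by (auto simp: momentum_lattice_def intro!: exI[of _ 0])

lemma covariance_cube:
  assumes L: "L > 0" and "\<beta> > 0" and y: "inv_fugacity s \<beta> \<rho> L = y" "y > 1"
  shows "covariance s \<beta> \<rho> L (\<lambda>x. a * indicator (cube L) x) = (norm a)\<^sup>2 * vol L * ((y + 1) / (y - 1))"
proof -
  let ?f = "\<lambda>x. a * indicator (cube L) x"
  have V: "vol L > 0" using L by (simp add: vol_def)
  define w where "w k = (1 + exp (- \<beta> * (energy s k - chem_potential s \<beta> \<rho> L))) /
        (1 - exp (- \<beta> * (energy s k - chem_potential s \<beta> \<rho> L)))" for k
  have "(\<Sum>\<^sub>\<infinity>k\<in>momentum_lattice L. w k * (norm (fourier_coeff L ?f k))\<^sup>2)
      = (\<Sum>\<^sub>\<infinity>k\<in>{0}. w k * (norm (fourier_coeff L ?f k))\<^sup>2)"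
    by (rule infsum_cong_neutral) (auto simp: fourier_coeff_cube[OF L] zero_in_momentum_lattice)
  also have "\<dots> = w 0 * ((2 * pi) powr (- 3 / 2) * norm a * vol L)\<^sup>2"
    using V by (simp add: fourier_coeff_cube[OF L zero_in_momentum_lattice] norm_mult)
  \<comment> \<open>The zero mode has energy 0, so both exponentials are exp(beta mu) = 1/y.\<close>
  also have "w 0 = (y + 1) / (y - 1)"
    using assms by (simp add: w_def energy_def chem_potential_def exp_minus divide_simps)
  \<comment> \<open>The power of 2 pi produced here cancels the prefactor of
    \<open>covariance\<close>.\<close>
  also have "((2 * pi) powr (- 3 / 2) * norm a * vol L)\<^sup>2 = (norm a)\<^sup>2 * (vol L)\<^sup>2 / (2 * pi) ^ 3"
  proof -
    have "((2 * pi) powr (- 3 / 2))\<^sup>2 = (2 * pi) powr (- 3)"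
      by (simp add: powr_power)
    also have "\<dots> = 1 / (2 * pi) ^ 3"
      by (subst powr_neg_numeral) simp_all
    finally show ?thesis by (simp only: power_mult_distrib times_divide_eq_left mult_1)
  qed
  finally have sum: "(\<Sum>\<^sub>\<infinity>k\<in>momentum_lattice L. w k * (norm (fourier_coeff L ?f k))\<^sup>2)
      = (y + 1) / (y - 1) * ((norm a)\<^sup>2 * (vol L)\<^sup>2 / (2 * pi) ^ 3)" .
  have "covariance s \<beta> \<rho> L ?f
      = (2 * pi) ^ 3 / vol L * (\<Sum>\<^sub>\<infinity>k\<in>momentum_lattice L. w k * (norm (fourier_coeff L ?f k))\<^sup>2)"
    by (simp only: covariance_def w_def)
  then show ?thesis
    using V unfolding sum by (simp add: power2_eq_square)
qed

lemma cube_function_L2: "(\<lambda>x. a * indicator (cube L) x) \<in> L2_cube L"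
proof -
  have "emeasure (lebesgue_on (cube L)) (space (lebesgue_on (cube L))) < \<infinity>"
    by (simp add: emeasure_restrict_space cube_def emeasure_lborel_cbox_eq)
  then interpret finite_measure "lebesgue_on (cube L)"
    by (intro finite_measureI) auto
  have "(\<lambda>x. a * indicator (cube L) x) \<in> borel_measurable (lebesgue_on (cube L))"
    by (intro measurable_restrict_space1) auto
  moreover have "integrable (lebesgue_on (cube L)) (\<lambda>x. (norm (a * indicator (cube L) x))\<^sup>2)"
    by (rule integrable_const_bound[where B = "(norm a)\<^sup>2"])
      (auto intro!: AE_I2 measurable_restrict_space1 simp: indicator_def norm_mult)
  ultimately show ?thesis by (simp add: L2_cube_def)
qed

lemma (in gibbs_state) expectation_resolvent_zero_mode:
  assumes L: "L > 0" and "\<beta> > 0" and y: "inv_fugacity s \<beta> \<rho> L = y" "y > 1"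
  shows "\<i> * vector_state J \<Omega> (resolvent_op J W 1 (zero_mode_fun n L))
    = of_real (laplace_gauss ((1 + 2 * zero_mode_number y) / vol L ^ n))"
proof -
  have V: "vol L > 0" using L by (simp add: vol_def)
  define c where "c = vol L powr (- (1 + real n) / 2)"
  \<comment> \<open>The squared normalisation is V^(-1-n); the volume factor from
    \<open>covariance_cube\<close> takes up one power.\<close>
  have c2: "c\<^sup>2 * vol L = 1 / vol L ^ n"
  proof -
    have "c\<^sup>2 * vol L = vol L powr (- (1 + real n)) * vol L powr 1"
      using V by (simp add: c_def powr_power add_divide_distrib diff_divide_distrib del: powr_one_gt_zero_iff)
    also have "\<dots> = vol L powr (- real n)" by (subst powr_add[symmetric]) simp
    finally show ?thesis using V by (simp add: powr_minus powr_realpow divide_inverse)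
  qed
  have f: "zero_mode_fun n L = (\<lambda>x. of_real c * indicator (cube L) x)"
    by (simp add: zero_mode_fun_def c_def fun_eq_iff)
  show ?thesis
  proof (rule expectation_resolvent)
    show "zero_mode_fun n L \<in> L2_cube L" unfolding f by (rule cube_function_L2)
    fix t :: real
    have "covariance s \<beta> \<rho> L (\<lambda>z. (of_real t * of_real c) * indicator (cube L) z)
        = (t * c)\<^sup>2 * vol L * ((y + 1) / (y - 1))"
      using covariance_cube[OF L assms(2) y, of "of_real t * of_real c"] by (simp add: norm_mult power_mult_distrib)
    also have "\<dots> = t\<^sup>2 * ((c\<^sup>2 * vol L) * ((y + 1) / (y - 1)))"
      by (simp add: power_mult_distrib)
    also have "(c\<^sup>2 * vol L) * ((y + 1) / (y - 1)) = (1 + 2 * zero_mode_number y) / vol L ^ n"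
      using y unfolding c2 by (simp add: zero_mode_number_def field_simps)
    finally show "covariance s \<beta> \<rho> L (\<lambda>z. of_real t * zero_mode_fun n L z)
        = t\<^sup>2 * ((1 + 2 * zero_mode_number y) / vol L ^ n)"
      unfolding f by (simp add: mult.assoc)
    show "(1 + 2 * zero_mode_number y) / vol L ^ n \<ge> 0"
      using V y by (simp add: zero_mode_number_def)
  qed
qed

section \<open>Lattice sums as integrals\<close>

lemma integrable_lborel_scaleR:
  fixes f :: "'a::euclidean_space \<Rightarrow> real"
  assumes f: "integrable lborel f" and "c \<noteq> 0"
  shows "integrable lborel (\<lambda>x. f (c *\<^sub>R x))"
proof -
  have [measurable]: "f \<in> borel_measurable borel"
    using borel_measurable_integrable[OF f] by simp
  have "integrable (density (distr lborel borel (\<lambda>x. 0 + c *\<^sub>R x)) (\<lambda>_. ennreal (\<bar>c\<bar> ^ DIM('a)))) f"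
    using f by (subst lborel_affine[OF assms(2), symmetric])
  then have "integrable lborel (\<lambda>x. \<bar>c\<bar> ^ DIM('a) *\<^sub>R f (0 + c *\<^sub>R x))"
    by (simp add: integrable_density integrable_distr_eq)
  then show ?thesis using assms(2) by simp
qed

lemma ennreal_term_le_suminf: "f n \<le> (\<Sum>n. f n :: ennreal)"
  using sum_le_suminf[of f "{n}"] by simp

text \<open>The function is dominated by the series of the indicators of balls of radius n + 1 with
  weights exp(-c n). The integral \<open>B n\<close> of a term is a power of n + 1 times a geometric
  factor.\<close>

lemma integrable_exp_minus_norm:
  assumes "c > 0"
  shows "integrable lborel (\<lambda>x::'a::euclidean_space. exp (- c * norm x))"
proof (rule integrableI_bounded)
  define B where "B n = unit_ball_vol (DIM('a)) * (real n + 1) ^ DIM('a) * exp (- c) ^ n" for n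
  have B: "B n > 0" for n by (simp add: B_def)
  have "summable B"
  proof -
    \<comment> \<open>These quotients tend to exp(-c) < 1, as the ratio test requires.\<close>
    have ratio: "((1 + inverse (real (Suc n))) ^ DIM('a)) * exp (- c) = B (Suc n) / B n" for n
    proof -
      have "unit_ball_vol (real DIM('a)) \<noteq> 0"
        by (rule less_imp_neq[OF unit_ball_vol_pos, symmetric]) simp
      then have "B (Suc n) / B n = ((real (Suc n) + 1) / (real n + 1)) ^ DIM('a) * exp (- c)"
        unfolding B_def by (simp add: power_divide)
      also have "(real (Suc n) + 1) / (real n + 1) = 1 + inverse (real (Suc n))"
        by (simp add: field_simps)
      finally show ?thesis by (rule sym)
    qed
    obtain d where d: "exp (- c) < d" "d < 1"
      using dense[of "exp (- c)" 1] assms by auto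
    have "(\<lambda>n. ((1 + inverse (real (Suc n))) ^ DIM('a)) * exp (- c)) \<longlonglongrightarrow> (1 + 0) ^ DIM('a) * exp (- c)"
      by (intro tendsto_intros LIMSEQ_inverse_real_of_nat)
    then have "eventually (\<lambda>n. B (Suc n) / B n < d) sequentially"
      unfolding ratio using d by (auto dest: order_tendstoD)
    then obtain N where N: "\<And>n. n \<ge> N \<Longrightarrow> B (Suc n) / B n < d"
      by (auto simp: eventually_sequentially)
    show ?thesis
    proof (rule summable_ratio_test[OF d(2)])
      fix n assume "N \<le> n"
      then have "B (Suc n) \<le> d * B n"
        using N[of n] B[of n] by (simp add: divide_less_eq)
      then show "norm (B (Suc n)) \<le> d * norm (B n)"
        using B[of n] B[of "Suc n"] by simp
    qed
  qed
  then have fin: "(\<Sum>n. ennreal (B n)) < \<infinity>"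
    using B by (subst suminf_ennreal2) (auto simp: less_imp_le)
  have B_eq: "ennreal (exp (- c) ^ n) * emeasure lborel (cball (0::'a) (real n + 1)) = ennreal (B n)" for n
    by (subst emeasure_cball) (simp_all add: B_def ac_simps ennreal_mult'[symmetric])
  have "(\<integral>\<^sup>+ (x::'a). ennreal (norm (exp (- c * norm x))) \<partial>lborel)
      \<le> (\<integral>\<^sup>+ (x::'a). (\<Sum>n. ennreal (exp (- c) ^ n) * indicator (cball 0 (real n + 1)) x) \<partial>lborel)"
  proof (rule nn_integral_mono)
    fix x :: 'a
    \<comment> \<open>One term of the series suffices at each point, the one whose index is the
      integer part of the norm.\<close>
    define n where "n = nat \<lfloor>norm x\<rfloor>"
    have n: "real n \<le> norm x" "norm x \<le> real n + 1"
    proof -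
      have "real n = of_int \<lfloor>norm x\<rfloor>" by (simp add: n_def)
      then show "real n \<le> norm x" "norm x \<le> real n + 1" by linarith+
    qed
    have ind: "indicator (cball 0 (real n + 1)) x = (1::ennreal)"
      using n by simp
    have "exp (- c * norm x) \<le> exp (- c) ^ n"
    proof -
      have "- c * norm x \<le> real n * - c"
        using mult_right_mono[OF n(1), of c] assms by (simp add: mult.commute[of c])
      then have "exp (- c * norm x) \<le> exp (real n * - c)" by (simp only: exp_le_cancel_iff)
      then show ?thesis by (simp only: exp_of_nat_mult)
    qed
    then have "ennreal (norm (exp (- c * norm x))) \<le> ennreal (exp (- c) ^ n) * indicator (cball 0 (real n + 1)) x"
      unfolding ind by (simp add: ennreal_leI)
    then show "ennreal (norm (exp (- c * norm x)))
        \<le> (\<Sum>n. ennreal (exp (- c) ^ n) * indicator (cball 0 (real n + 1)) x)"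
      using ennreal_term_le_suminf by (rule order_trans)
  qed
  moreover have "(\<integral>\<^sup>+ (x::'a). (\<Sum>n. ennreal (exp (- c) ^ n) * indicator (cball 0 (real n + 1)) x) \<partial>lborel)
      = (\<Sum>n. \<integral>\<^sup>+ (x::'a). ennreal (exp (- c) ^ n) * indicator (cball 0 (real n + 1)) x \<partial>lborel)"
    by (rule nn_integral_suminf)
      (intro borel_measurable_times_ennreal borel_measurable_const borel_measurable_indicator, simp)
  moreover have "(\<integral>\<^sup>+ (x::'a). ennreal (exp (- c) ^ n) * indicator (cball 0 (real n + 1)) x \<partial>lborel) = ennreal (B n)" for n
    unfolding B_eq[symmetric] by (rule nn_integral_cmult_indicator) simp
  ultimately show "(\<integral>\<^sup>+ (x::'a). ennreal (norm (exp (- c * norm x))) \<partial>lborel) < \<infinity>"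
    using fin by simp
qed simp

section \<open>Rounding to a cubic grid\<close>

definition grid :: "real \<Rightarrow> (real ^ 'n) set" where
  "grid a = {k. \<forall>i. \<exists>n::int. k $ i = a * of_int n}"

text \<open>The nearest grid point in each coordinate, upwards at ties. For positive
  \<open>a\<close> the cells are half-open cubes of side \<open>a\<close> centred at the grid
  points, and they partition the space.\<close>

definition grid_round :: "real \<Rightarrow> real ^ 'n \<Rightarrow> real ^ 'n" where
  "grid_round a x = (\<chi> i. a * of_int \<lfloor>x $ i / a + 1 / 2\<rfloor>)"

lemma countable_grid: "countable (grid a :: (real ^ 'n) set)"
proof (rule countable_subset)
  show "(grid a :: (real ^ 'n) set) \<subseteq> range (\<lambda>n::'n \<Rightarrow> int. \<chi> i. a * of_int (n i))"
  proof
    fix k :: "real ^ 'n" assume "k \<in> grid a"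
    then have "\<forall>i. \<exists>n::int. k $ i = a * of_int n" by (simp add: grid_def)
    from choice[OF this] obtain n :: "'n \<Rightarrow> int" where "\<And>i. k $ i = a * of_int (n i)"
      by blast
    then show "k \<in> range (\<lambda>n::'n \<Rightarrow> int. \<chi> i. a * of_int (n i))"
      by (intro image_eqI[of _ _ n]) (auto simp: vec_eq_iff)
  qed
qed auto

lemma grid_round_in: "grid_round a x \<in> grid a"
  by (auto simp: grid_round_def grid_def)

lemma grid_round_eq_iff:
  assumes "a > 0" "k \<in> grid a"
  shows "grid_round a x = k \<longleftrightarrow> (\<forall>i. k $ i - a / 2 \<le> x $ i \<and> x $ i < k $ i + a / 2)"
proof -
  have "a * of_int \<lfloor>x $ i / a + 1 / 2\<rfloor> = k $ i \<longleftrightarrow> k $ i - a / 2 \<le> x $ i \<and> x $ i < k $ i + a / 2" for i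
  proof -
    obtain n :: int where n: "k $ i = a * of_int n" using assms(2) by (auto simp: grid_def)
    have "a * of_int \<lfloor>x $ i / a + 1 / 2\<rfloor> = k $ i \<longleftrightarrow> \<lfloor>x $ i / a + 1 / 2\<rfloor> = n"
      using assms(1) by (simp add: n)
    also have "\<dots> \<longleftrightarrow> k $ i - a / 2 \<le> x $ i \<and> x $ i < k $ i + a / 2"
      unfolding floor_eq_iff n using assms(1) by (auto simp: field_simps)
    finally show ?thesis .
  qed
  then show ?thesis by (simp add: grid_round_def vec_eq_iff)
qed

lemma grid_round_close:
  fixes x :: "real ^ 'n"
  assumes "a > 0"
  shows "norm (grid_round a x - x) \<le> real CARD('n) * a / 2"
proof -
  have "\<bar>(grid_round a x - x) $ i\<bar> \<le> a / 2" for i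
    using spec[OF iffD1[OF grid_round_eq_iff[OF assms grid_round_in[of a x]] refl], of i]
    by (simp only: vector_minus_component abs_le_iff) linarith
  then have "(\<Sum>i\<in>UNIV. \<bar>(grid_round a x - x) $ i\<bar>) \<le> real CARD('n) * (a / 2)"
    by (rule sum_bounded_above)
  then show ?thesis using norm_le_l1_cart[of "grid_round a x - x"] by simp
qed

lemma norm_grid_ge:
  assumes "a > 0" "k \<in> grid a" "k \<noteq> 0"
  shows "norm k \<ge> a"
proof -
  obtain i where i: "k $ i \<noteq> 0" using assms(3) by (auto simp: vec_eq_iff)
  obtain n :: int where n: "k $ i = a * of_int n" using assms(2) by (auto simp: grid_def)
  have "n \<noteq> 0" using i n by auto
  then have "a * 1 \<le> a * \<bar>of_int n\<bar>" using assms(1) by (intro mult_left_mono) linarith+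
  also have "\<dots> = \<bar>k $ i\<bar>" using assms(1) by (simp add: n abs_mult)
  also have "\<dots> \<le> norm k" by (rule component_le_norm_cart)
  finally show ?thesis by simp
qed

lemma grid_round_measurable [measurable]: "grid_round a \<in> borel_measurable borel"
  unfolding borel_measurable_euclidean_space[of "grid_round a"]
proof
  fix b :: "real ^ 'n" assume "b \<in> Basis"
  then obtain i where b: "b = axis i 1" by (auto simp: Basis_vec_def)
  have "(\<lambda>x::real ^ 'n. a * of_int \<lfloor>(x \<bullet> axis i 1) / a + 1 / 2\<rfloor>) \<in> borel_measurable borel"
    by measurable
  then show "(\<lambda>x. grid_round a x \<bullet> b) \<in> borel_measurable borel"
    by (simp add: b grid_round_def inner_axis)
qed

text \<open>A cell lies between the open and the closed box with the same corners, which have equal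
  volume.\<close>

lemma emeasure_grid_cell:
  fixes k :: "real ^ 'n"
  assumes "a > 0" "k \<in> grid a"
  shows "emeasure lborel {x. grid_round a x = k} = ennreal (a ^ CARD('n))"
proof (rule antisym)
  have meas: "{x. grid_round a x = k} \<in> sets borel"
    using measurable_sets[OF grid_round_measurable, of "{k}" a] by (simp add: vimage_def)
  have *: "b \<in> Basis \<Longrightarrow> (\<chi> i. k $ i + c) \<bullet> b = k \<bullet> b + c" for b :: "real ^ 'n" and c
    by (auto simp: Basis_vec_def inner_axis)
  have le: "(\<chi> i. k $ i + - a / 2) \<bullet> b \<le> (\<chi> i. k $ i + a / 2) \<bullet> b" if "b \<in> Basis" for b :: "real ^ 'n"
    unfolding *[OF that] using assms(1) by simp
  have prod: "(\<Prod>b\<in>Basis. ((\<chi> i. k $ i + a / 2) - (\<chi> i. k $ i + - a / 2)) \<bullet> b) = a ^ CARD('n)"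
  proof -
    have "((\<chi> i. k $ i + a / 2) - (\<chi> i. k $ i + - a / 2)) \<bullet> b = a" if "b \<in> Basis" for b :: "real ^ 'n"
      by (simp add: inner_diff_left *[OF that] del: add_uminus_conv_diff)
    then show ?thesis by simp
  qed
  have "emeasure lborel {x. grid_round a x = k} \<le> emeasure lborel (cbox (\<chi> i. k $ i + - a / 2) (\<chi> i. k $ i + a / 2))"
    by (rule emeasure_mono) (auto simp: grid_round_eq_iff[OF assms] mem_box_cart less_imp_le)
  also have "\<dots> = ennreal (a ^ CARD('n))"
    unfolding prod[symmetric] by (rule emeasure_lborel_cbox) (rule le)
  finally show "emeasure lborel {x. grid_round a x = k} \<le> ennreal (a ^ CARD('n))" .
  have "ennreal (a ^ CARD('n)) = emeasure lborel (box (\<chi> i. k $ i + - a / 2) (\<chi> i. k $ i + a / 2))"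
    unfolding prod[symmetric] by (rule emeasure_lborel_box[symmetric]) (rule le)
  also have "\<dots> \<le> emeasure lborel {x. grid_round a x = k}"
    by (rule emeasure_mono) (use meas in \<open>auto simp: grid_round_eq_iff[OF assms] mem_box_cart less_imp_le\<close>)
  finally show "ennreal (a ^ CARD('n)) \<le> emeasure lborel {x. grid_round a x = k}" .
qed

text \<open>The integrand is a countable sum of values \<open>F k\<close> times indicators of cells;
  sum and integral may be interchanged.\<close>

lemma nn_integral_grid_round:
  fixes F :: "real ^ 'n \<Rightarrow> ennreal"
  assumes "a > 0"
  shows "(\<integral>\<^sup>+ x. F (grid_round a x) \<partial>lborel) = ennreal (a ^ CARD('n)) * (\<integral>\<^sup>+ k. F k \<partial>count_space (grid a))"
proof -
  let ?C = "\<lambda>k. {x. grid_round a x = k}"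
  have meas [measurable]: "?C k \<in> sets borel" for k
    using measurable_sets[OF grid_round_measurable, of "{k}" a] by (simp add: vimage_def)
  have "F (grid_round a x) = (\<integral>\<^sup>+ k. F k * indicator (?C k) x \<partial>count_space (grid a))" for x
  proof -
    have "(\<integral>\<^sup>+ k. F k * indicator (?C k) x \<partial>count_space (grid a))
        = (\<integral>\<^sup>+ k. F (grid_round a x) * indicator {grid_round a x} k \<partial>count_space (grid a))"
      by (intro nn_integral_cong) (auto simp: indicator_def)
    also have "\<dots> = F (grid_round a x)"
      by (subst nn_integral_cmult_indicator) (auto simp: grid_round_in)
    finally show ?thesis ..
  qed
  then have "(\<integral>\<^sup>+ x. F (grid_round a x) \<partial>lborel)
      = (\<integral>\<^sup>+ x. \<integral>\<^sup>+ k. F k * indicator (?C k) x \<partial>count_space (grid a) \<partial>lborel)"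
    by simp
  also have "\<dots> = (\<integral>\<^sup>+ k. \<integral>\<^sup>+ x. F k * indicator (?C k) x \<partial>lborel \<partial>count_space (grid a))"
    by (intro nn_integral_count_space_nn_integral countable_grid) auto
  also have "\<dots> = (\<integral>\<^sup>+ k. ennreal (a ^ CARD('n)) * F k \<partial>count_space (grid a))"
    by (intro nn_integral_cong) (simp add: nn_integral_cmult emeasure_grid_cell[OF assms] mult.commute)
  finally show ?thesis by (simp add: nn_integral_cmult)
qed

text \<open>Integrability of the step function bounds the nonnegative sum, so \<open>F\<close> is
  integrable for the counting measure and hence unconditionally summable.\<close>

lemma grid_sum_eq_integral:
  fixes F :: "real ^ 'n \<Rightarrow> real"
  assumes a: "a > 0" and int: "integrable lborel (\<lambda>x. F (grid_round a x))" and F: "\<And>k. F k \<ge> 0"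
  shows "F summable_on grid a"
    and "(\<Sum>\<^sub>\<infinity>k\<in>grid a. F k) = (LINT x|lborel. F (grid_round a x)) / a ^ CARD('n)"
proof -
  define I where "I = (LINT x|lborel. F (grid_round a x))"
  have I: "I \<ge> 0" unfolding I_def using F by simp
  have "ennreal I = ennreal (a ^ CARD('n)) * (\<integral>\<^sup>+ k. ennreal (F k) \<partial>count_space (grid a))"
    using nn_integral_grid_round[OF a, of "\<lambda>k. ennreal (F k)"] F
    by (simp add: I_def nn_integral_eq_integral[OF int])
  then have "ennreal (1 / a ^ CARD('n)) * ennreal I
      = ennreal (1 / a ^ CARD('n)) * (ennreal (a ^ CARD('n)) * (\<integral>\<^sup>+ k. ennreal (F k) \<partial>count_space (grid a)))"
    by (rule arg_cong)
  then have nn: "(\<integral>\<^sup>+ k. ennreal (F k) \<partial>count_space (grid a)) = ennreal (I / a ^ CARD('n))"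
    using a I by (simp add: mult.assoc[symmetric] flip: ennreal_mult)
  have int: "integrable (count_space (grid a)) F"
    by (rule integrableI_nn_integral_finite[OF _ _ nn]) (use F in auto)
  then have abs: "Infinite_Set_Sum.abs_summable_on F (grid a)"
    by (simp add: Infinite_Set_Sum.abs_summable_on_def)
  then show "F summable_on grid a"
    using abs_summable_equivalent abs_summable_summable by blast
  have "(\<Sum>\<^sub>\<infinity>k\<in>grid a. F k) = integral\<^sup>L (count_space (grid a)) F"
    using infsetsum_infsum[OF abs] by (simp add: infsetsum_def)
  also have "\<dots> = I / a ^ CARD('n)"
    using nn_integral_eq_integral[OF int] nn F I a by simp
  finally show "(\<Sum>\<^sub>\<infinity>k\<in>grid a. F k) = (LINT x|lborel. F (grid_round a x)) / a ^ CARD('n)"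
    by (simp add: I_def)
qed

section \<open>Thermodynamic limit\<close>

definition occupation :: "real \<Rightarrow> real \<Rightarrow> real \<Rightarrow> real ^ 3 \<Rightarrow> real" where
  "occupation s \<beta> y k = 1 / (y * exp (\<beta> * energy s k) - 1)"

lemma energy_nonneg: "energy s k \<ge> 0"
  by (simp add: energy_def)

lemma energy_0 [simp]: "energy s 0 = 0"
  by (simp add: energy_def)

lemma energy_pos: "k \<noteq> 0 \<Longrightarrow> energy s k > 0"
  by (simp add: energy_def)

lemma energy_mono: "s \<ge> 0 \<Longrightarrow> norm k \<le> norm k' \<Longrightarrow> energy s k \<le> energy s k'"
  by (simp add: energy_def powr_mono2)

text \<open>A linear lower bound, which makes the occupation numbers decay exponentially. Inside the
  unit ball the left-hand side is negative.\<close>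

lemma energy_ge:
  assumes "s \<ge> 1" shows "norm k - 1 \<le> energy s k"
proof (cases "norm k \<ge> 1")
  case True
  then have "norm k powr 1 \<le> norm k powr s" using assms by (intro powr_mono) auto
  then show ?thesis using True by (simp add: energy_def)
next
  case False
  then show ?thesis using energy_nonneg[of s k] by linarith
qed

lemma energy_measurable [measurable]: "energy s \<in> borel_measurable borel"
  unfolding energy_def[abs_def] by measurable

lemma occupation_measurable [measurable]: "occupation s \<beta> y \<in> borel_measurable borel"
  unfolding occupation_def[abs_def] by measurable

section \<open>Bounds and monotonicity of the occupation numbers\<close>

locale bose_gas =
  fixes s \<beta> :: real
  assumes s: "s \<ge> 1" and \<beta>: "\<beta> > 0"
begin

lemma exp_energy_ge_1: "exp (\<beta> * energy s k) \<ge> 1"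
  using \<beta> energy_nonneg[of s k] by simp

text \<open>The alternative in the hypothesis admits the critical value y = 1, at which only the
  zero mode is singular.\<close>

lemma denominator_pos:
  assumes "y > 1 \<or> (y \<ge> 1 \<and> k \<noteq> 0)"
  shows "y * exp (\<beta> * energy s k) - 1 > 0"
  using assms
proof
  assume "y > 1"
  then have "1 * 1 < y * exp (\<beta> * energy s k)"
    using exp_energy_ge_1[of k] by (intro mult_less_le_imp_less) auto
  then show ?thesis by simp
next
  assume *: "y \<ge> 1 \<and> k \<noteq> 0"
  then have "1 < exp (\<beta> * energy s k)" using \<beta> energy_pos[of k s] by simp
  then have "1 * 1 < y * exp (\<beta> * energy s k)"
    using * by (intro mult_le_less_imp_less) auto
  then show ?thesis by simp
qed

lemma occupation_pos: "y > 1 \<or> (y \<ge> 1 \<and> k \<noteq> 0) \<Longrightarrow> occupation s \<beta> y k > 0"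
  using denominator_pos by (simp add: occupation_def)

lemma occupation_antimono:
  assumes "y > 1 \<or> (y \<ge> 1 \<and> k \<noteq> 0)" "y \<le> y'" "norm k \<le> norm k'"
  shows "occupation s \<beta> y' k' \<le> occupation s \<beta> y k"
proof -
  have "exp (\<beta> * energy s k) \<le> exp (\<beta> * energy s k')"
    using assms(3) s \<beta> by (simp add: energy_mono)
  then have "y * exp (\<beta> * energy s k) \<le> y' * exp (\<beta> * energy s k')"
    using assms by (intro mult_mono) auto
  then show ?thesis
    unfolding occupation_def using denominator_pos[OF assms(1)] by (intro divide_left_mono) auto
qed

text \<open>With e the exponential of beta h(k), y / (y e - 1) = 1 / (e - 1/y) decreases in y, while
  (y - 1) / (y e - 1) increases because e is at least 1. Both facts survive summation and take the
  place of derivative estimates for the densities.\<close>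

lemma occupation_ratio:
  assumes "1 < y" "y \<le> y'"
  shows "y' * occupation s \<beta> y' k \<le> y * occupation s \<beta> y k"
    and "(y - 1) * occupation s \<beta> y k \<le> (y' - 1) * occupation s \<beta> y' k"
proof -
  define e where "e = exp (\<beta> * energy s k)"
  have e: "e \<ge> 1" unfolding e_def by (rule exp_energy_ge_1)
  have pos: "y * e - 1 > 0" "y' * e - 1 > 0"
    using denominator_pos[of y k] denominator_pos[of y' k] assms by (auto simp: e_def)
  have "y' * (y * e - 1) \<le> y * (y' * e - 1)" using assms by (simp add: algebra_simps)
  then show "y' * occupation s \<beta> y' k \<le> y * occupation s \<beta> y k"
    using pos unfolding occupation_def e_def[symmetric] by (simp add: divide_simps)
  have "0 \<le> (y' - y) * (e - 1)" using assms e by simp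
  then have "(y - 1) * (y' * e - 1) \<le> (y' - 1) * (y * e - 1)" by (simp add: algebra_simps)
  then show "(y - 1) * occupation s \<beta> y k \<le> (y' - 1) * occupation s \<beta> y' k"
    using pos unfolding occupation_def e_def[symmetric] by (simp add: divide_simps)
qed

lemma integrable_occupation:
  assumes "y > 1" shows "integrable lborel (occupation s \<beta> y)"
proof (rule Bochner_Integration.integrable_bound)
  show "integrable lborel (\<lambda>k::real ^ 3. exp \<beta> / (y - 1) * exp (- \<beta> * norm k))"
    using integrable_exp_minus_norm[OF \<beta>] by (intro integrable_mult_right)
  show "AE k in lborel. norm (occupation s \<beta> y k) \<le> norm (exp \<beta> / (y - 1) * exp (- \<beta> * norm k))"
  proof (rule AE_I2)
    fix k :: "real ^ 3"
    define e where "e = exp (\<beta> * energy s k)"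
    have e: "e \<ge> 1" unfolding e_def by (rule exp_energy_ge_1)
    have "exp (\<beta> * (norm k - 1)) \<le> e"
      unfolding e_def using energy_ge[OF s, of k] \<beta> by simp
    then have "(y - 1) * exp (\<beta> * (norm k - 1)) \<le> (y - 1) * e"
      using assms by (intro mult_left_mono) auto
    \<comment> \<open>The difference of the two sides is e - 1.\<close>
    also have "\<dots> \<le> y * e - 1" using e by (simp add: algebra_simps)
    finally have "occupation s \<beta> y k \<le> 1 / ((y - 1) * exp (\<beta> * (norm k - 1)))"
      unfolding occupation_def e_def[symmetric] using assms denominator_pos[of y k]
      by (intro divide_left_mono mult_pos_pos) (auto simp: e_def)
    also have "\<dots> = exp \<beta> / (y - 1) * exp (- \<beta> * norm k)"
      by (simp add: right_diff_distrib exp_diff exp_minus divide_simps)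
    finally show "norm (occupation s \<beta> y k) \<le> norm (exp \<beta> / (y - 1) * exp (- \<beta> * norm k))"
      using occupation_pos[of y k] assms by simp
  qed
qed simp

section \<open>Density of the excited modes and its infinite volume limit\<close>

definition excited_occupation :: "real \<Rightarrow> real ^ 3 \<Rightarrow> real" where
  "excited_occupation y k = (if k = 0 then 0 else occupation s \<beta> y k)"

text \<open>For y > 1 this is 1/V times the sum over the nonzero momenta: a grid cell has volume (2
  pi)^3 / V.\<close>

definition excited_density :: "real \<Rightarrow> real \<Rightarrow> real" where
  "excited_density L y = (LINT x|lborel. excited_occupation y (grid_round (2 * pi / L) x)) / (2 * pi) ^ 3"

text \<open>At y = 1 this is the critical density if the integrand is integrable, and 0 by
  convention otherwise. Facts at y = 1 therefore rest on integrability.\<close>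

definition limit_density :: "real \<Rightarrow> real" where
  "limit_density y = (LINT k|lborel. occupation s \<beta> y k) / (2 * pi) ^ 3"

lemma excited_occupation_measurable [measurable]: "excited_occupation y \<in> borel_measurable borel"
  unfolding excited_occupation_def[abs_def] by measurable

lemma excited_occupation_nonneg: "y \<ge> 1 \<Longrightarrow> excited_occupation y k \<ge> 0"
  using occupation_pos[of y k] by (auto simp: excited_occupation_def)

text \<open>A grid point that is not zero is at least one third as far from the origin as any point of
  its cell, which gives a dominating function that does not depend on the grid.\<close>

lemma excited_occupation_bound:
  fixes x :: "real ^ 3"
  assumes "a > 0" "y1 \<ge> 1" "y \<ge> y1" "x \<noteq> 0"
  shows "norm (excited_occupation y (grid_round a x)) \<le> occupation s \<beta> y1 ((1 / 3) *\<^sub>R x)"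
proof (cases "grid_round a x = 0")
  case True
  then show ?thesis using occupation_pos[of y1 "(1 / 3) *\<^sub>R x"] assms by (auto simp: excited_occupation_def)
next
  case False
  have "norm x \<le> norm (grid_round a x) + norm (grid_round a x - x)"
    by (metis norm_minus_commute norm_triangle_sub)
  also have "\<dots> \<le> norm (grid_round a x) + 3 * a / 2"
    using grid_round_close[OF assms(1), of x] by simp
  also have "\<dots> \<le> 3 * norm (grid_round a x)"
    using norm_grid_ge[OF assms(1) grid_round_in False] assms(1) by linarith
  finally have "occupation s \<beta> y (grid_round a x) \<le> occupation s \<beta> y1 ((1 / 3) *\<^sub>R x)"
    using assms by (intro occupation_antimono) auto
  then show ?thesis using excited_occupation_nonneg[of y "grid_round a x"] assms False
    by (simp add: excited_occupation_def)
qed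

lemma integrable_excited_occupation:
  assumes "a > 0" "y \<ge> 1" "integrable lborel (occupation s \<beta> y)"
  shows "integrable lborel (\<lambda>x. excited_occupation y (grid_round a x))"
proof (rule Bochner_Integration.integrable_bound)
  show "integrable lborel (\<lambda>x. occupation s \<beta> y ((1 / 3) *\<^sub>R x))"
    using assms(3) by (rule integrable_lborel_scaleR) simp
  show "AE x in lborel. norm (excited_occupation y (grid_round a x)) \<le> norm (occupation s \<beta> y ((1 / 3) *\<^sub>R x))"
    using AE_lborel_singleton[of 0]
  proof eventually_elim
    case (elim x)
    have "norm (excited_occupation y (grid_round a x)) \<le> occupation s \<beta> y ((1 / 3) *\<^sub>R x)"
      using elim assms by (intro excited_occupation_bound) auto
    then show ?case by (rule order_trans) simp
  qed
qed simp

lemma momentum_lattice_eq_grid: "momentum_lattice L = grid (2 * pi / L)"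
  by (simp add: momentum_lattice_def grid_def)

lemma
  assumes "L > 0" "y > 1"
  shows summable_occupation: "occupation s \<beta> y summable_on momentum_lattice L"
    and mean_density_split: "mean_density s \<beta> L y = zero_mode_number y / vol L + excited_density L y"
proof -
  define a where "a = 2 * pi / L"
  have a: "a > 0" using assms by (simp add: a_def)
  have V: "vol L > 0" using assms by (simp add: vol_def)
  have zero: "0 \<in> grid a" by (auto simp: grid_def intro!: exI[of _ 0])
  note sums = grid_sum_eq_integral[OF a integrable_excited_occupation[OF a _ integrable_occupation], of y]
  have summable: "excited_occupation y summable_on grid a"
    and total: "(\<Sum>\<^sub>\<infinity>k\<in>grid a. excited_occupation y k) = (LINT x|lborel. excited_occupation y (grid_round a x)) / a ^ 3"
    using sums excited_occupation_nonneg[of y] assms by auto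
  have "excited_occupation y summable_on (grid a - {0})"
    using summable by (rule summable_on_subset_banach) auto
  then have "occupation s \<beta> y summable_on (grid a - {0})"
    by (rule summable_on_cong[THEN iffD1, rotated]) (auto simp: excited_occupation_def)
  then have "occupation s \<beta> y summable_on (insert 0 (grid a - {0}))"
    by (subst summable_on_insert_iff)
  then show sum: "occupation s \<beta> y summable_on momentum_lattice L"
    by (simp only: insert_Diff[OF zero] momentum_lattice_eq_grid a_def[symmetric])
  have "(\<Sum>\<^sub>\<infinity>k\<in>grid a. occupation s \<beta> y k) = (\<Sum>\<^sub>\<infinity>k\<in>insert 0 (grid a - {0}). occupation s \<beta> y k)"
    by (simp only: insert_Diff[OF zero])
  also have "\<dots> = occupation s \<beta> y 0 + (\<Sum>\<^sub>\<infinity>k\<in>grid a - {0}. occupation s \<beta> y k)"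
    by (rule infsum_insert) (use \<open>occupation s \<beta> y summable_on (grid a - {0})\<close> in auto)
  also have "(\<Sum>\<^sub>\<infinity>k\<in>grid a - {0}. occupation s \<beta> y k) = (\<Sum>\<^sub>\<infinity>k\<in>grid a. excited_occupation y k)"
    by (rule infsum_cong_neutral) (auto simp: excited_occupation_def)
  finally have "mean_density s \<beta> L y
      = 1 / vol L * (zero_mode_number y + (LINT x|lborel. excited_occupation y (grid_round a x)) / a ^ 3)"
    by (simp add: mean_density_def momentum_lattice_eq_grid total occupation_def[symmetric] a_def[symmetric])
      (simp add: occupation_def zero_mode_number_def)
  then show "mean_density s \<beta> L y = zero_mode_number y / vol L + excited_density L y"
    using assms V by (simp add: excited_density_def a_def[symmetric] distrib_left)
      (simp add: a_def vol_def power_divide)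
qed

text \<open>\<open>y\<close> may vary with the volume; its lower bound \<open>y1\<close> provides
  the majorant. A constant \<open>y\<close> serves for fixed fugacity, and \<open>y1 = 1\<close> for
  the limit to the critical point.\<close>

lemma tendsto_excited_density:
  assumes y: "(y \<longlongrightarrow> y0) at_top" "eventually (\<lambda>L. y L \<ge> y1) at_top" and "y1 \<ge> 1"
    and int: "integrable lborel (occupation s \<beta> y1)"
  shows "((\<lambda>L. excited_density L (y L)) \<longlongrightarrow> limit_density y0) at_top"
  unfolding excited_density_def limit_density_def
proof (intro tendsto_divide tendsto_const)
  have y0: "y0 \<ge> y1"
    by (rule tendsto_lowerbound[OF y]) simp
  show "((\<lambda>L. LINT x|lborel. excited_occupation (y L) (grid_round (2 * pi / L) x))
      \<longlongrightarrow> (LINT k|lborel. occupation s \<beta> y0 k)) at_top"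
  proof (rule integral_dominated_convergence_at_top)
    show "integrable lborel (\<lambda>x. occupation s \<beta> y1 ((1 / 3) *\<^sub>R x))"
      using int by (rule integrable_lborel_scaleR) simp
    show "\<forall>\<^sub>F L in at_top. AE x in lborel. norm (excited_occupation (y L) (grid_round (2 * pi / L) x))
        \<le> occupation s \<beta> y1 ((1 / 3) *\<^sub>R x)"
      using y(2) eventually_gt_at_top[of 0]
    proof eventually_elim
      case (elim L)
      show ?case using AE_lborel_singleton[of 0]
        by eventually_elim (rule excited_occupation_bound, use elim assms in auto)
    qed
    show "AE x in lborel. ((\<lambda>L. excited_occupation (y L) (grid_round (2 * pi / L) x)) \<longlongrightarrow> occupation s \<beta> y0 x) at_top"
      using AE_lborel_singleton[of 0]
    proof eventually_elim
      case (elim x)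
      have "((\<lambda>L. 3 * (2 * pi / L) / 2) \<longlongrightarrow> 3 * 0 / 2) at_top"
        by (intro tendsto_intros tendsto_divide_0[OF tendsto_const] filterlim_at_top_imp_at_infinity filterlim_ident) simp
      then have lim0: "((\<lambda>L. 3 * (2 * pi / L) / 2) \<longlongrightarrow> 0) at_top" by simp
      have "eventually (\<lambda>L. norm (grid_round (2 * pi / L) x - x) \<le> 3 * (2 * pi / L) / 2) at_top"
        using eventually_gt_at_top[of 0]
      proof eventually_elim
        case (elim L)
        then show ?case using grid_round_close[of "2 * pi / L" x] by simp
      qed
      then have "((\<lambda>L. grid_round (2 * pi / L) x - x) \<longlongrightarrow> 0) at_top"
        using lim0 by (rule Lim_null_comparison)
      then have round: "((\<lambda>L. grid_round (2 * pi / L) x) \<longlongrightarrow> x) at_top"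
        by (simp add: LIM_zero_iff)
      have "((\<lambda>L. occupation s \<beta> (y L) (grid_round (2 * pi / L) x)) \<longlongrightarrow> occupation s \<beta> y0 x) at_top"
        unfolding occupation_def energy_def
        using denominator_pos[of y0 x] elim y0 assms(3)
        by (intro tendsto_intros y(1) round) (auto simp: energy_def)
      \<comment> \<open>Rounding converges to a nonzero point, so the rounded point is eventually
        not the zero mode.\<close>
      moreover have "eventually (\<lambda>L. occupation s \<beta> (y L) (grid_round (2 * pi / L) x)
          = excited_occupation (y L) (grid_round (2 * pi / L) x)) at_top"
        using tendsto_imp_eventually_ne[OF round elim]
        by eventually_elim (simp add: excited_occupation_def)
      ultimately show ?case by (rule Lim_transform_eventually)
    qed
  qed simp_all
qed simp


section \<open>Monotonicity of the densities in the inverse fugacity\<close>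

lemma limit_density_ratio:
  assumes "1 < y" "y \<le> y'"
  shows "y' * limit_density y' \<le> y * limit_density y"
proof -
  have "(LINT k|lborel. y' * occupation s \<beta> y' k) \<le> (LINT k|lborel. y * occupation s \<beta> y k)"
    using assms by (intro integral_mono integrable_mult_right integrable_occupation occupation_ratio(1)) auto
  then show ?thesis by (simp add: limit_density_def divide_right_mono)
qed

lemma limit_density_nonneg: "y > 1 \<Longrightarrow> limit_density y \<ge> 0"
  unfolding limit_density_def using occupation_pos
  by (intro divide_nonneg_nonneg Bochner_Integration.integral_nonneg) (auto intro: less_imp_le)

lemma limit_density_antimono:
  assumes "1 < y" "y \<le> y'" shows "limit_density y' \<le> limit_density y"
proof -
  have "(LINT k|lborel. occupation s \<beta> y' k) \<le> (LINT k|lborel. occupation s \<beta> y k)"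
    using assms by (intro integral_mono integrable_occupation occupation_antimono) auto
  then show ?thesis by (simp add: limit_density_def divide_right_mono)
qed

lemma mean_density_mono:
  assumes "L > 0" "1 < y" "y \<le> y'"
  shows "y' * mean_density s \<beta> L y' \<le> y * mean_density s \<beta> L y"
    and "(y - 1) * mean_density s \<beta> L y \<le> (y' - 1) * mean_density s \<beta> L y'"
proof -
  have V: "vol L > 0" using assms by (simp add: vol_def)
  have eq: "c * mean_density s \<beta> L z = (\<Sum>\<^sub>\<infinity>k\<in>momentum_lattice L. c * occupation s \<beta> z k) / vol L" for c z
    by (simp add: mean_density_def infsum_cmult_right' flip: occupation_def)
  have sum: "(\<lambda>k. c * occupation s \<beta> z k) summable_on momentum_lattice L" if "z > 1" for c z
    by (intro summable_on_cmult_right summable_occupation that assms(1))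
  show "y' * mean_density s \<beta> L y' \<le> y * mean_density s \<beta> L y"
    unfolding eq using V assms by (intro divide_right_mono infsum_mono sum occupation_ratio) auto
  show "(y - 1) * mean_density s \<beta> L y \<le> (y' - 1) * mean_density s \<beta> L y'"
    unfolding eq using V assms by (intro divide_right_mono infsum_mono sum occupation_ratio) auto
qed

lemma excited_density_nonneg: "y \<ge> 1 \<Longrightarrow> excited_density L y \<ge> 0"
  unfolding excited_density_def by (intro divide_nonneg_nonneg Bochner_Integration.integral_nonneg excited_occupation_nonneg) auto

lemma mean_density_ge: "L > 0 \<Longrightarrow> y > 1 \<Longrightarrow> zero_mode_number y / vol L \<le> mean_density s \<beta> L y"
  using mean_density_split excited_density_nonneg by simp

lemma mean_density_pos:
  assumes "L > 0" "y > 1" shows "mean_density s \<beta> L y > 0"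
proof -
  have "0 < zero_mode_number y / vol L" using assms by (simp add: zero_mode_number_def vol_def)
  also have "\<dots> \<le> mean_density s \<beta> L y" using assms by (rule mean_density_ge)
  finally show ?thesis .
qed

text \<open>Strictness comes from positivity of the density at \<open>y'\<close>, combined with
  monotonicity of y times the density.\<close>

lemma mean_density_strict_antimono:
  assumes "L > 0" "1 < y" "y < y'"
  shows "mean_density s \<beta> L y' < mean_density s \<beta> L y"
proof -
  have "y * mean_density s \<beta> L y' < y' * mean_density s \<beta> L y'"
    using assms mean_density_pos[of L y'] by simp
  also have "\<dots> \<le> y * mean_density s \<beta> L y" using assms by (intro mean_density_mono) auto
  finally show ?thesis using assms by simp
qed

text \<open>Continuity follows from monotonicity of the density \<open>D\<close> and of \<open>(y - 1) D\<close> in opposite directions.\<close>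

lemma continuous_on_mean_density:
  assumes L: "L > 0" shows "continuous_on {1<..} (mean_density s \<beta> L)"
proof (rule continuous_at_imp_continuous_on, rule ballI)
  fix y :: real assume "y \<in> {1<..}"
  then have y: "y > 1" by simp
  let ?D = "mean_density s \<beta> L"
  have "(?D \<longlongrightarrow> ?D y) (at y)"
  proof (rule tendsto_sandwich)
    have r: "((\<lambda>z. (y - 1) / (z - 1)) \<longlongrightarrow> (y - 1) / (y - 1)) (at y)"
      using y by (intro tendsto_intros) auto
    show "((\<lambda>z. min 1 ((y - 1) / (z - 1)) * ?D y) \<longlongrightarrow> ?D y) (at y)"
      using tendsto_mult[OF tendsto_min[OF tendsto_const r] tendsto_const, of 1 "?D y"] y by simp
    show "((\<lambda>z. max 1 ((y - 1) / (z - 1)) * ?D y) \<longlongrightarrow> ?D y) (at y)"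
      using tendsto_mult[OF tendsto_max[OF tendsto_const r] tendsto_const, of 1 "?D y"] y by simp
    have ev: "eventually (\<lambda>z. z > 1) (at y)"
      using y by (rule order_tendstoD(1)[OF tendsto_ident_at])
    have bounds: "min 1 ((y - 1) / (z - 1)) * ?D y \<le> ?D z \<and> ?D z \<le> max 1 ((y - 1) / (z - 1)) * ?D y"
      if z: "z > 1" for z
    proof -
      define r where "r = (y - 1) / (z - 1)"
      have "min 1 r * ?D y \<le> ?D z \<and> ?D z \<le> max 1 r * ?D y"
      proof (cases "y \<le> z")
        case True
        have "?D z \<le> ?D y"
          using mean_density_strict_antimono[OF L y, of z] True by (cases "y = z") auto
        moreover have "r * ?D y \<le> ?D z"
          using mean_density_mono(2)[OF L y True] z by (simp add: r_def divide_simps mult.commute)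
        moreover have "r \<le> 1" using True z by (simp add: r_def)
        ultimately show ?thesis by (simp add: min_def max_def)
      next
        case False
        have "?D y \<le> ?D z"
          using mean_density_strict_antimono[OF L z, of y] False by simp
        moreover have "?D z \<le> r * ?D y"
          using mean_density_mono(2)[OF L z, of y] False z by (simp add: r_def divide_simps mult.commute)
        moreover have "r \<ge> 1" using False z by (simp add: r_def)
        ultimately show ?thesis by (simp add: min_def max_def)
      qed
      then show ?thesis by (simp only: r_def)
    qed
    show "eventually (\<lambda>z. min 1 ((y - 1) / (z - 1)) * ?D y \<le> ?D z) (at y)"
      using ev by eventually_elim (use bounds in blast)
    show "eventually (\<lambda>z. ?D z \<le> max 1 ((y - 1) / (z - 1)) * ?D y) (at y)"
      using ev by eventually_elim (use bounds in blast)
  qed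
  then show "isCont ?D y" by (simp add: isCont_def)
qed

section \<open>Existence and uniqueness of the inverse fugacity\<close>

lemma inv_fugacity:
  assumes L: "L > 0" and \<rho>: "\<rho> > 0"
  shows "inv_fugacity s \<beta> \<rho> L > 1" "mean_density s \<beta> L (inv_fugacity s \<beta> \<rho> L) = \<rho>"
proof -
  let ?D = "mean_density s \<beta> L"
  have V: "vol L > 0" using L by (simp add: vol_def)
  \<comment> \<open>At this value the zero mode alone has density exactly
    \<open>\<rho>\<close>.\<close>
  define y1 where "y1 = 1 + 1 / (vol L * \<rho>)"
  have y1: "y1 > 1" using V \<rho> by (simp add: y1_def)
  have D1: "\<rho> \<le> ?D y1"
    using mean_density_ge[OF L y1] V \<rho> by (simp add: zero_mode_number_def y1_def)
  \<comment> \<open>Chosen so that y1 D(y1) = y2 \<open>\<rho>\<close>; since y D(y) decreases,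
    D(y2) is at most \<open>\<rho>\<close>.\<close>
  define y2 where "y2 = y1 * (?D y1 / \<rho>)"
  have y2: "y1 \<le> y2"
    unfolding y2_def using D1 \<rho> y1 mult_left_mono[of 1 "?D y1 / \<rho>" y1] by simp
  have "y2 * ?D y2 \<le> y2 * \<rho>"
    using mean_density_mono(1)[OF L y1 y2] \<rho> by (simp add: y2_def)
  then have D2: "?D y2 \<le> \<rho>" using y1 y2 by simp
  have "\<exists>y\<ge>y1. y \<le> y2 \<and> ?D y = \<rho>"
    using y1 by (intro IVT2' D1 D2 y2 continuous_on_subset[OF continuous_on_mean_density[OF L]]) auto
  then obtain y where "y1 \<le> y" "?D y = \<rho>" by blast
  then have y: "y > 1 \<and> ?D y = \<rho>" using y1 by simp
  then have "\<exists>!y. y > 1 \<and> ?D y = \<rho>"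
  proof (rule ex1I)
    fix z assume "z > 1 \<and> ?D z = \<rho>"
    then show "z = y"
      using mean_density_strict_antimono[OF L, of y z] mean_density_strict_antimono[OF L, of z y] y
      by (cases z y rule: linorder_cases) auto
  qed
  from theI'[OF this] show "inv_fugacity s \<beta> \<rho> L > 1" "?D (inv_fugacity s \<beta> \<rho> L) = \<rho>"
    by (simp_all add: inv_fugacity_def)
qed

lemma inv_fugacity_less:
  assumes "L > 0" "\<rho> > 0" "y > 1" "mean_density s \<beta> L y < \<rho>"
  shows "inv_fugacity s \<beta> \<rho> L < y"
  using inv_fugacity[OF assms(1,2)] mean_density_strict_antimono[OF assms(1,3), of "inv_fugacity s \<beta> \<rho> L"] assms
  by (cases "inv_fugacity s \<beta> \<rho> L" y rule: linorder_cases) auto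

lemma inv_fugacity_greater:
  assumes "L > 0" "\<rho> > 0" "y > 1" "mean_density s \<beta> L y > \<rho>"
  shows "y < inv_fugacity s \<beta> \<rho> L"
  using inv_fugacity[OF assms(1,2)] mean_density_strict_antimono[OF assms(1) inv_fugacity(1)[OF assms(1,2)], of y] assms
  by (cases "inv_fugacity s \<beta> \<rho> L" y rule: linorder_cases) auto

section \<open>Limit of the inverse fugacity\<close>

lemma inverse_vol_tendsto_0: "((\<lambda>L. c / vol L) \<longlongrightarrow> 0) at_top"
  unfolding vol_def
  by (intro tendsto_divide_0[OF tendsto_const] filterlim_at_top_imp_at_infinity filterlim_pow_at_top filterlim_ident) simp

lemma tendsto_mean_density:
  assumes "y > 1" shows "((\<lambda>L. mean_density s \<beta> L y) \<longlongrightarrow> limit_density y) at_top"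
proof -
  have "((\<lambda>L. zero_mode_number y / vol L + excited_density L y) \<longlongrightarrow> 0 + limit_density y) at_top"
    using assms by (intro tendsto_add inverse_vol_tendsto_0 tendsto_excited_density[of _ _ y] integrable_occupation) auto
  moreover have "eventually (\<lambda>L. zero_mode_number y / vol L + excited_density L y = mean_density s \<beta> L y) at_top"
    using eventually_gt_at_top[of 0] by eventually_elim (simp add: mean_density_split assms)
  ultimately show ?thesis by (simp add: Lim_transform_eventually)
qed

text \<open>A generalised inverse of \<open>limit_density\<close>. The adjoined 1 is its value when
  the limit density nowhere exceeds \<open>\<rho>\<close>.\<close>

definition limit_fugacity :: "real \<Rightarrow> real" where
  "limit_fugacity \<rho> = Sup (insert 1 {y. y > 1 \<and> limit_density y > \<rho>})"

lemma limit_fugacity_bdd: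
  assumes "\<rho> > 0" shows "bdd_above (insert 1 {y. y > 1 \<and> limit_density y > \<rho>})"
proof -
  have "y \<le> max 2 (2 * limit_density 2 / \<rho>)" if "y > 1" "limit_density y > \<rho>" for y
  proof (cases "y \<ge> 2")
    case True
    have "y * \<rho> \<le> y * limit_density y" using that by simp
    also have "\<dots> \<le> 2 * limit_density 2" using True by (intro limit_density_ratio) auto
    finally show ?thesis using assms by (simp add: le_max_iff_disj field_simps)
  qed simp
  then show ?thesis by (auto intro!: bdd_aboveI[of _ "max 2 (2 * limit_density 2 / \<rho>)"])
qed

lemma limit_fugacity_ge_1: "\<rho> > 0 \<Longrightarrow> limit_fugacity \<rho> \<ge> 1"
  unfolding limit_fugacity_def by (intro cSup_upper limit_fugacity_bdd) auto

text \<open>A fixed point above 1 on either side of the limit has limit density strictly above or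
  below \<open>\<rho>\<close>, hence so has its density in large volumes, and monotonicity locates
  the inverse fugacity.\<close>

lemma tendsto_inv_fugacity:
  assumes \<rho>: "\<rho> > 0"
  shows "(inv_fugacity s \<beta> \<rho> \<longlongrightarrow> limit_fugacity \<rho>) at_top"
proof (rule order_tendstoI)
  have pos: "eventually (\<lambda>L::real. L > 0) at_top" by (rule eventually_gt_at_top)
  fix a assume a: "a < limit_fugacity \<rho>"
  show "eventually (\<lambda>L. a < inv_fugacity s \<beta> \<rho> L) at_top"
  proof (cases "a > 1")
    case True
    obtain z where z: "z > 1" "limit_density z > \<rho>" "a < z"
      using a True less_cSup_iff[OF _ limit_fugacity_bdd[OF \<rho>], of a] unfolding limit_fugacity_def by auto
    then have "limit_density a > \<rho>" using limit_density_antimono[OF True, of z] by simp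
    then have "eventually (\<lambda>L. mean_density s \<beta> L a > \<rho>) at_top"
      by (rule order_tendstoD(1)[OF tendsto_mean_density[OF True]])
    then show ?thesis
      using pos by eventually_elim (rule inv_fugacity_greater[OF _ \<rho> True])
  next
    case False
    show ?thesis using pos by eventually_elim (use False inv_fugacity(1)[OF _ \<rho>] in force)
  qed
next
  fix b assume b: "limit_fugacity \<rho> < b"
  \<comment> \<open>At \<open>z\<close> only a weak inequality is known; passing from
    \<open>z\<close> to \<open>b\<close> with \<open>limit_density_ratio\<close> makes it
    strict.\<close>
  obtain z where z: "limit_fugacity \<rho> < z" "z < b" using dense[OF b] by blast
  have z1: "z > 1" using z limit_fugacity_ge_1[OF \<rho>] by simp
  have "limit_density z \<le> \<rho>"
    using cSup_upper[OF _ limit_fugacity_bdd[OF \<rho>], of z] z z1 unfolding limit_fugacity_def by force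
  have "b * limit_density b \<le> z * limit_density z" using z z1 by (intro limit_density_ratio) auto
  also have "\<dots> \<le> z * \<rho>" using \<open>limit_density z \<le> \<rho>\<close> z1 by (intro mult_left_mono) auto
  also have "\<dots> < b * \<rho>" using z \<rho> by simp
  finally have "limit_density b < \<rho>" using z z1 by simp
  then have "eventually (\<lambda>L. mean_density s \<beta> L b < \<rho>) at_top"
    using z z1 by (intro order_tendstoD(2)[OF tendsto_mean_density]) auto
  then show "eventually (\<lambda>L. inv_fugacity s \<beta> \<rho> L < b) at_top"
    using eventually_gt_at_top[of 0] by eventually_elim (use z z1 \<rho> inv_fugacity_less in auto)
qed

section \<open>Critical density and the two regimes\<close>

lemma nn_integral_occupation:
  assumes "y \<ge> 1" "integrable lborel (occupation s \<beta> y)"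
  shows "ennreal (1 / (2 * pi) ^ 3) * (\<integral>\<^sup>+ k. ennreal (occupation s \<beta> y k) \<partial>lborel) = ennreal (limit_density y)"
proof -
  have nonneg: "AE k in lborel. 0 \<le> occupation s \<beta> y k"
    using AE_lborel_singleton[of 0]
    by eventually_elim (use occupation_pos assms(1) in \<open>auto intro: less_imp_le\<close>)
  show ?thesis
    unfolding nn_integral_eq_integral[OF assms(2) nonneg] limit_density_def
    using integral_nonneg_AE[OF nonneg] by (simp flip: ennreal_mult)
qed

lemma critical_density_ge: "y > 1 \<Longrightarrow> ennreal (limit_density y) \<le> critical_density s \<beta>"
proof -
  assume y: "y > 1"
  have "(\<integral>\<^sup>+ k. ennreal (occupation s \<beta> y k) \<partial>lborel) \<le> (\<integral>\<^sup>+ k. ennreal (occupation s \<beta> 1 k) \<partial>lborel)"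
  proof (rule nn_integral_mono_AE)
    show "AE k in lborel. ennreal (occupation s \<beta> y k) \<le> ennreal (occupation s \<beta> 1 k)"
      using AE_lborel_singleton[of 0]
      by eventually_elim (use y in \<open>auto intro!: ennreal_leI occupation_antimono\<close>)
  qed
  then have "ennreal (1 / (2 * pi) ^ 3) * (\<integral>\<^sup>+ k. ennreal (occupation s \<beta> y k) \<partial>lborel)
      \<le> ennreal (1 / (2 * pi) ^ 3) * (\<integral>\<^sup>+ k. ennreal (occupation s \<beta> 1 k) \<partial>lborel)"
    by (rule mult_left_mono) simp
  then show ?thesis
    using nn_integral_occupation[OF _ integrable_occupation[OF y]] y
    by (simp add: critical_density_def occupation_def[of s \<beta> 1])
qed

text \<open>Fatou's lemma along a sequence decreasing to 1; finiteness of the critical density is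
  part of the conclusion.\<close>

lemma critical_density_le:
  assumes \<rho>: "\<And>y. y > 1 \<Longrightarrow> limit_density y \<le> \<rho>"
  shows "critical_density s \<beta> \<le> ennreal \<rho>"
proof -
  define y where "y n = 1 + inverse (real (Suc n))" for n
  have y1: "y n > 1" for n by (simp add: y_def)
  have ylim: "y \<longlonglongrightarrow> 1"
    unfolding y_def using tendsto_add[OF tendsto_const LIMSEQ_inverse_real_of_nat, of 1] by simp
  have "(\<integral>\<^sup>+ k. ennreal (occupation s \<beta> 1 k) \<partial>lborel)
      = (\<integral>\<^sup>+ k. liminf (\<lambda>n. ennreal (occupation s \<beta> (y n) k)) \<partial>lborel)"
  proof (rule nn_integral_cong_AE)
    show "AE k in lborel. ennreal (occupation s \<beta> 1 k) = liminf (\<lambda>n. ennreal (occupation s \<beta> (y n) k))"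
      using AE_lborel_singleton[of 0]
    proof eventually_elim
      case (elim k)
      have "(\<lambda>n. occupation s \<beta> (y n) k) \<longlonglongrightarrow> occupation s \<beta> 1 k"
        unfolding occupation_def using denominator_pos[of 1 k] elim by (intro tendsto_intros ylim) auto
      then have "(\<lambda>n. ennreal (occupation s \<beta> (y n) k)) \<longlonglongrightarrow> ennreal (occupation s \<beta> 1 k)"
        by (rule tendsto_ennrealI)
      then show ?case by (rule lim_imp_Liminf[OF trivial_limit_sequentially, symmetric])
    qed
  qed
  also have "\<dots> \<le> liminf (\<lambda>n. \<integral>\<^sup>+ k. ennreal (occupation s \<beta> (y n) k) \<partial>lborel)"
    by (rule nn_integral_liminf) simp
  also have "\<dots> \<le> limsup (\<lambda>n. \<integral>\<^sup>+ k. ennreal (occupation s \<beta> (y n) k) \<partial>lborel)"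
    by (rule Liminf_le_Limsup) simp
  also have "\<dots> \<le> ennreal ((2 * pi) ^ 3 * \<rho>)"
  proof (rule Limsup_bounded, rule always_eventually, rule allI)
    fix n
    have "(\<integral>\<^sup>+ k. ennreal (occupation s \<beta> (y n) k) \<partial>lborel) = ennreal ((2 * pi) ^ 3 * limit_density (y n))"
      unfolding limit_density_def
      using y1[of n] by (subst nn_integral_eq_integral) (auto intro!: integrable_occupation less_imp_le occupation_pos)
    also have "\<dots> \<le> ennreal ((2 * pi) ^ 3 * \<rho>)"
      using \<rho>[OF y1] by (intro ennreal_leI mult_left_mono) auto
    finally show "(\<integral>\<^sup>+ k. ennreal (occupation s \<beta> (y n) k) \<partial>lborel) \<le> ennreal ((2 * pi) ^ 3 * \<rho>)" .
  qed
  finally have "critical_density s \<beta> \<le> ennreal (1 / (2 * pi) ^ 3) * ennreal ((2 * pi) ^ 3 * \<rho>)"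
    unfolding critical_density_def occupation_def by (intro mult_left_mono) (auto simp: mult_1)
  also have "\<dots> = ennreal \<rho>"
  proof -
    have "\<rho> \<ge> 0" using \<rho>[of 2] limit_density_nonneg[of 2] by simp
    then show ?thesis by (simp flip: ennreal_mult)
  qed
  finally show ?thesis .
qed

text \<open>The critical density is the least upper bound of the limit densities for y > 1, so it is
  at most \<open>\<rho>\<close> exactly if no such y has a larger limit density.\<close>

lemma limit_fugacity_eq_1_iff:
  assumes "\<rho> > 0"
  shows "limit_fugacity \<rho> = 1 \<longleftrightarrow> critical_density s \<beta> \<le> ennreal \<rho>"
proof
  assume eq: "limit_fugacity \<rho> = 1"
  show "critical_density s \<beta> \<le> ennreal \<rho>"
  proof (rule critical_density_le, rule ccontr)
    fix y :: real assume "y > 1" "\<not> limit_density y \<le> \<rho>"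
    then show False
      using cSup_upper[OF _ limit_fugacity_bdd[OF assms], of y] eq unfolding limit_fugacity_def by simp
  qed
next
  assume le: "critical_density s \<beta> \<le> ennreal \<rho>"
  have "limit_density y \<le> \<rho>" if "y > 1" for y
    using order_trans[OF critical_density_ge[OF that] le] assms by (simp add: ennreal_le_iff)
  then have "{y. y > 1 \<and> limit_density y > \<rho>} = {}" by force
  then show "limit_fugacity \<rho> = 1" unfolding limit_fugacity_def by (simp only:) simp
qed

lemma tendsto_zero_mode_density_subcritical:
  assumes \<rho>: "\<rho> > 0" and crit: "ennreal \<rho> < critical_density s \<beta>"
  shows "limit_fugacity \<rho> > 1"
    and "((\<lambda>L. zero_mode_number (inv_fugacity s \<beta> \<rho> L)) \<longlongrightarrow> zero_mode_number (limit_fugacity \<rho>)) at_top"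
    and "((\<lambda>L. zero_mode_number (inv_fugacity s \<beta> \<rho> L) / vol L) \<longlongrightarrow> 0) at_top"
proof -
  show y: "limit_fugacity \<rho> > 1"
    using limit_fugacity_eq_1_iff[OF \<rho>] limit_fugacity_ge_1[OF \<rho>] crit by force
  then show lim: "((\<lambda>L. zero_mode_number (inv_fugacity s \<beta> \<rho> L)) \<longlongrightarrow> zero_mode_number (limit_fugacity \<rho>)) at_top"
    unfolding zero_mode_number_def by (intro tendsto_intros tendsto_inv_fugacity[OF \<rho>]) auto
  show "((\<lambda>L. zero_mode_number (inv_fugacity s \<beta> \<rho> L) / vol L) \<longlongrightarrow> 0) at_top"
    using tendsto_mult[OF lim inverse_vol_tendsto_0[of 1]] by simp
qed

text \<open>Equality with the critical density is included: the occupation number of the zero mode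
  diverges there too, though its density tends to 0.\<close>

lemma tendsto_zero_mode_density_supercritical:
  assumes \<rho>: "\<rho> > 0" and crit: "critical_density s \<beta> \<le> ennreal \<rho>"
  shows "filterlim (\<lambda>L. zero_mode_number (inv_fugacity s \<beta> \<rho> L)) at_top at_top"
    and "((\<lambda>L. zero_mode_number (inv_fugacity s \<beta> \<rho> L) / vol L) \<longlongrightarrow> \<rho> - limit_density 1) at_top"
    and "critical_density s \<beta> = ennreal (limit_density 1)" "limit_density 1 \<ge> 0"
proof -
  have ylim: "(inv_fugacity s \<beta> \<rho> \<longlongrightarrow> 1) at_top"
    using tendsto_inv_fugacity[OF \<rho>] crit limit_fugacity_eq_1_iff[OF \<rho>] by simp
  have y1: "eventually (\<lambda>L. inv_fugacity s \<beta> \<rho> L > 1) at_top"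
    using eventually_gt_at_top[of 0] by eventually_elim (rule inv_fugacity(1)[OF _ \<rho>])
  have "filterlim (\<lambda>L. inv_fugacity s \<beta> \<rho> L - 1) (at_right 0) at_top"
    unfolding filterlim_at using y1 tendsto_diff[OF ylim tendsto_const[of 1]]
    by (auto elim!: eventually_mono)
  then show "filterlim (\<lambda>L. zero_mode_number (inv_fugacity s \<beta> \<rho> L)) at_top at_top"
    using filterlim_compose[OF filterlim_inverse_at_top_right]
    by (simp add: zero_mode_number_def inverse_eq_divide)
  have nonneg: "AE k in lborel. 0 \<le> occupation s \<beta> 1 k"
    using AE_lborel_singleton[of 0]
    by eventually_elim (use occupation_pos in \<open>auto intro: less_imp_le\<close>)
  \<comment> \<open>Finiteness makes the occupation at y = 1 integrable, so that it can serve as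
    majorant while the inverse fugacity tends to 1.\<close>
  have "critical_density s \<beta> < \<infinity>"
    using crit by (rule le_less_trans) simp
  then have "(\<integral>\<^sup>+ k. ennreal (occupation s \<beta> 1 k) \<partial>lborel) < \<infinity>"
    unfolding critical_density_def occupation_def by (auto simp: ennreal_mult_less_top ennreal_mult_eq_top_iff less_top)
  then have int: "integrable lborel (occupation s \<beta> 1)"
    using nonneg by (intro integrableI_nonneg) auto
  show "critical_density s \<beta> = ennreal (limit_density 1)"
    using nn_integral_occupation[OF _ int] by (simp add: critical_density_def occupation_def)
  show "limit_density 1 \<ge> 0"
    unfolding limit_density_def using integral_nonneg_AE[OF nonneg] by simp
  have "((\<lambda>L. \<rho> - excited_density L (inv_fugacity s \<beta> \<rho> L)) \<longlongrightarrow> \<rho> - limit_density 1) at_top"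
    using y1 by (intro tendsto_diff tendsto_const tendsto_excited_density[OF ylim _ _ int]) (auto elim: eventually_mono)
  moreover have "eventually (\<lambda>L. \<rho> - excited_density L (inv_fugacity s \<beta> \<rho> L)
      = zero_mode_number (inv_fugacity s \<beta> \<rho> L) / vol L) at_top"
    using eventually_gt_at_top[of 0] y1
  proof eventually_elim
    case (elim L)
    then show ?case using mean_density_split[of L "inv_fugacity s \<beta> \<rho> L"] inv_fugacity(2)[OF _ \<rho>, of L] by simp
  qed
  ultimately show "((\<lambda>L. zero_mode_number (inv_fugacity s \<beta> \<rho> L) / vol L) \<longlongrightarrow> \<rho> - limit_density 1) at_top"
    by (rule Lim_transform_eventually)
qed

end

section \<open>Order parameters\<close>

lemma order_parameter_eqI:
  assumes "(resolvent_expectation n J W \<Omega> \<longlongrightarrow> complex_of_real r) at_top"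
  shows "order_parameter n J W \<Omega> = r"
  unfolding order_parameter_def
proof (rule the_equality)
  show "(resolvent_expectation n J W \<Omega> \<longlongrightarrow> complex_of_real r) at_top" by (rule assms)
  fix r' assume "(resolvent_expectation n J W \<Omega> \<longlongrightarrow> complex_of_real r') at_top"
  from tendsto_unique[OF _ this assms] show "r' = r" by simp
qed

text \<open>The first two conjuncts ensure that the quantities defined by \<open>Lim\<close> and
  \<open>THE\<close> are true limits. The equivalences with the vanishing of the order parameter for
  n = 0 exclude the critical density itself: there the zero mode occupation diverges, so this
  parameter is 0, while the condensate density is 0 and the parameter for n = 1 is 1.\<close>

theorem proposition3p6:
  fixes s \<beta> \<rho> :: real
    and J :: "real \<Rightarrow> 'h::{real_inner, complete_space} \<Rightarrow> 'h"
    and W :: "real \<Rightarrow> (real ^ 3 \<Rightarrow> complex) \<Rightarrow> 'h \<Rightarrow> 'h"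
    and \<Omega> :: "real \<Rightarrow> 'h"
  assumes "s \<ge> 1" and "\<beta> > 0" and "\<rho> > 0"
    and "\<And>L. L > 0 \<Longrightarrow> gibbs_state s \<beta> \<rho> L (J L) (W L) (\<Omega> L)"
  shows "((\<lambda>L. zero_mode_number (inv_fugacity s \<beta> \<rho> L) / vol L)
            \<longlongrightarrow> condensate_density s \<beta> \<rho>) at_top
       \<and> (\<forall>n\<in>{0, 1}. (resolvent_expectation n J W \<Omega>
            \<longlongrightarrow> complex_of_real (order_parameter n J W \<Omega>)) at_top
            \<and> order_parameter n J W \<Omega> \<in> {0..1})
       \<and> (condensate_density s \<beta> \<rho> > 0 \<longleftrightarrow> order_parameter 1 J W \<Omega> < 1)
       \<and> (condensate_density s \<beta> \<rho> > 0 \<longrightarrow> order_parameter 0 J W \<Omega> = 0)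
       \<and> (ennreal \<rho> \<noteq> critical_density s \<beta> \<longrightarrow>
            (condensate_density s \<beta> \<rho> > 0 \<longleftrightarrow> order_parameter 0 J W \<Omega> = 0)
          \<and> (order_parameter 0 J W \<Omega> = 0 \<longleftrightarrow> order_parameter 1 J W \<Omega> < 1))"
proof -
  interpret bose_gas s \<beta> by unfold_locales (use assms in auto)
  define N where "N L = zero_mode_number (inv_fugacity s \<beta> \<rho> L)" for L
  have pos: "eventually (\<lambda>L::real. L > 0) at_top" by (rule eventually_gt_at_top)
  have N: "N L > 0" if "L > 0" for L
    using inv_fugacity(1)[OF that assms(3)] by (simp add: N_def zero_mode_number_def)
  have res: "resolvent_expectation n J W \<Omega> L = of_real (laplace_gauss ((1 + 2 * N L) / vol L ^ n))"
    if "L > 0" for n L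
    using gibbs_state.expectation_resolvent_zero_mode[OF assms(4)[OF that] that assms(2) refl
        inv_fugacity(1)[OF that assms(3)], of n]
    by (simp add: resolvent_expectation_def N_def)
  have nonneg: "eventually (\<lambda>L. (1 + 2 * N L) / vol L ^ n \<ge> 0) at_top" for n
    using pos
  proof eventually_elim
    case (elim L)
    then show ?case using N[OF elim] by (intro divide_nonneg_nonneg zero_le_power) (auto simp: vol_def)
  qed
  have resI: "(resolvent_expectation n J W \<Omega> \<longlongrightarrow> complex_of_real r) at_top"
    if "((\<lambda>L. laplace_gauss ((1 + 2 * N L) / vol L ^ n)) \<longlongrightarrow> r) at_top" for n r
    using tendsto_of_real[OF that]
    by (rule Lim_transform_eventually) (rule eventually_mono[OF pos], simp only: res)
  have condI: "condensate_density s \<beta> \<rho> = d" if "((\<lambda>L. N L / vol L) \<longlongrightarrow> d) at_top" for d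
    using tendsto_Lim[OF _ that] by (simp add: condensate_density_def N_def)
  have o1: "((\<lambda>L. laplace_gauss ((1 + 2 * N L) / vol L ^ 1)) \<longlongrightarrow> laplace_gauss (2 * d)) at_top"
    if "((\<lambda>L. N L / vol L) \<longlongrightarrow> d) at_top" for d
  proof (rule tendsto_laplace_gauss[OF _ nonneg])
    \<comment> \<open>For n = 1 the covariance is 1/V + 2 N/V, so only the condensate density
      survives in the limit.\<close>
    have "((\<lambda>L. 1 / vol L + 2 * (N L / vol L)) \<longlongrightarrow> 0 + 2 * d) at_top"
      by (intro tendsto_intros inverse_vol_tendsto_0 that)
    then show "((\<lambda>L. (1 + 2 * N L) / vol L ^ 1) \<longlongrightarrow> 2 * d) at_top"
      by (simp add: add_divide_distrib)
  qed
  show ?thesis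
  proof (cases "critical_density s \<beta> \<le> ennreal \<rho>")
    case True
    note super = tendsto_zero_mode_density_supercritical[OF assms(3) True, folded N_def]
    define d where "d = \<rho> - limit_density 1"
    have cond: "condensate_density s \<beta> \<rho> = d" unfolding d_def by (rule condI[OF super(2)])
    have d: "d \<ge> 0" "ennreal \<rho> \<noteq> critical_density s \<beta> \<Longrightarrow> d > 0"
      using True super(3,4) assms(3) by (auto simp: d_def ennreal_le_iff less_le)
    note lim1 = resI[OF o1[OF super(2), folded d_def]]
    have "filterlim (\<lambda>L. (1 + 2 * N L) / vol L ^ 0) at_top at_top"
      using filterlim_tendsto_add_at_top[OF tendsto_const
          filterlim_tendsto_pos_mult_at_top[OF tendsto_const _ super(1)], of 2 1] by simp
    note lim0 = resI[OF tendsto_laplace_gauss_at_top[OF this]]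
    note o0 = order_parameter_eqI[OF lim0] and o1 = order_parameter_eqI[OF lim1]
    \<comment> \<open>The case d = 0 is exactly that of the critical density.\<close>
    show ?thesis
    proof (cases "d = 0")
      case True
      then show ?thesis
        using super(2) lim0 lim1 d(2) unfolding N_def[symmetric]
        by (auto simp: cond o0 o1 laplace_gauss_0 d_def[symmetric] simp del: One_nat_def)
    next
      case False
      then show ?thesis
        using super(2) lim0 lim1 d laplace_gauss_pos[of "2 * d"] laplace_gauss_less_1[of "2 * d"]
        unfolding N_def[symmetric] by (auto simp: cond o0 o1 d_def[symmetric] simp del: One_nat_def)
    qed
  next
    case False
    then have crit: "ennreal \<rho> < critical_density s \<beta>" by simp
    note sub = tendsto_zero_mode_density_subcritical[OF assms(3) crit, folded N_def]
    have cond: "condensate_density s \<beta> \<rho> = 0" by (rule condI[OF sub(3)])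
    note lim1 = resI[OF o1[OF sub(3)]]
    \<comment> \<open>The finite limit of the covariance for n = 0, which keeps this order parameter
      positive.\<close>
    define q where "q = 1 + 2 * zero_mode_number (limit_fugacity \<rho>)"
    have q: "q > 0" unfolding q_def using sub(1) by (simp add: zero_mode_number_def add_pos_nonneg)
    have "((\<lambda>L. (1 + 2 * N L) / vol L ^ 0) \<longlongrightarrow> q) at_top"
      unfolding q_def power_0 div_by_1 by (intro tendsto_intros sub(2))
    note lim0 = resI[OF tendsto_laplace_gauss[OF this nonneg]]
    note o0 = order_parameter_eqI[OF lim0] and o1 = order_parameter_eqI[OF lim1]
    show ?thesis
      using sub(3) lim0 lim1 laplace_gauss_pos[of q] laplace_gauss_le_1[of q] q
      unfolding N_def[symmetric] by (auto simp: cond o0 o1 laplace_gauss_0 simp del: One_nat_def)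
  qed
qed

end
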